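(* For every $X$ in the operator norm closed linear span $\overline{\mathrm{span}}\{M_fV_\lambda: f\in L^\infty(\mathbb T),\lambda\in\mathbb T\}\subseteq B(L^2(\mathbb T))$ one has $$\|PXP\|=\|X\|.$$ In particular, $$\Big\|\sum_{j=1}^n c_jT_{\lambda_j,f_j}\Big\|=\Big\|\sum_{j=1}^n c_jM_{f_j}V_{\lambda_j}\Big\|$$ for all $n\in\mathbb N$, $c_j\in\mathbb C$, $f_j\in L^\infty(\mathbb T)$, $\lambda_j\in\mathbb T$, $1\le j\le n$.
   Context: $\mathbb T$ is the unit circle with normalized Haar measure; $L^2(\mathbb T)$ has orthonormal basis $e_n(z)=z^n$, $n\in\mathbb Z$; $H^2(\mathbb T)$ is the closed span of $\{e_n:n\ge0\}$; $P$ is the orthogonal projection of $L^2(\mathbb T)$ onto $H^2(\mathbb T)$. For $f\in L^\infty(\mathbb T)$, $M_f$ is multiplication by $f$ on $L^2(\mathbb T)$. For $\lambda\in\mathbb T$, $V_\lambda$ is the unitary on $L^2(\mathbb T)$ with $(V_\lambda h)(z)=h(\lambda z)$. $T_{\lambda,f}=PM_fV_\lambda|_{H^2(\mathbb T)}\in B(H^2(\mathbb T))$ is called the $\lambda$-Toeplitz operator with symbol $f$. *)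

theory Defs
  imports "HOL-Analysis.Analysis"
begin

section \<open>Complex normed vector spaces\<close>

text \<open>The library has complex scalar multiplication only through locales, while
  \<open>'a \<Rightarrow>\<^sub>L 'b\<close> is a real normed space.  This class adds complex scalars.\<close>

class complex_normed_vector = real_normed_vector +
  fixes scaleC :: "complex \<Rightarrow> 'a \<Rightarrow> 'a" (infixr "*\<^sub>C" 75)
  assumes scaleC_add_right: "a *\<^sub>C (x + y) = a *\<^sub>C x + a *\<^sub>C y"
    and scaleC_add_left: "(a + b) *\<^sub>C x = a *\<^sub>C x + b *\<^sub>C x"
    and scaleC_scaleC: "a *\<^sub>C (b *\<^sub>C x) = (a * b) *\<^sub>C x"
    and scaleR_scaleC: "r *\<^sub>R x = complex_of_real r *\<^sub>C x"
    and norm_scaleC: "norm (a *\<^sub>C x) = norm a * norm x"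

lemma scaleC_one: "1 *\<^sub>C x = (x :: 'a :: complex_normed_vector)"
  using scaleR_scaleC[of 1 x] by simp

global_interpretation complex_vector:
  vector_space "scaleC :: complex \<Rightarrow> 'a \<Rightarrow> 'a :: complex_normed_vector"
  by unfold_locales (simp_all add: scaleC_add_right scaleC_add_left scaleC_scaleC scaleC_one)

lemma bounded_linear_scaleC:
  "bounded_linear (\<lambda>x. a *\<^sub>C (x :: 'a :: complex_normed_vector))"
proof (rule bounded_linear_intro[where K = "norm a"])
  show "a *\<^sub>C (r *\<^sub>R x) = r *\<^sub>R (a *\<^sub>C x)" for r and x :: 'a
    by (simp add: scaleR_scaleC scaleC_scaleC mult.commute)
qed (simp_all add: scaleC_add_right norm_scaleC mult.commute)

lemma onorm_scaleC:
  fixes f :: "'a :: real_normed_vector \<Rightarrow> 'b :: complex_normed_vector"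
  assumes "bounded_linear f"
  shows "onorm (\<lambda>x. a *\<^sub>C f x) = norm a * onorm f"
proof -
  have "onorm (\<lambda>x. a *\<^sub>C f x) = onorm (\<lambda>x. norm a *\<^sub>R f x)"
    by (simp add: onorm_def norm_scaleC)
  also have "\<dots> = norm a * onorm f"
    using onorm_scaleR[OF assms, of "norm a"] by simp
  finally show ?thesis .
qed

instantiation blinfun :: (real_normed_vector, complex_normed_vector) complex_normed_vector
begin

lift_definition scaleC_blinfun :: "complex \<Rightarrow> 'a \<Rightarrow>\<^sub>L 'b \<Rightarrow> 'a \<Rightarrow>\<^sub>L 'b"
  is "\<lambda>a X x. a *\<^sub>C X x"
  by (rule bounded_linear_compose[OF bounded_linear_scaleC])

instance
proof
  fix a b :: complex and r :: real and x y :: "'a \<Rightarrow>\<^sub>L 'b"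
  show "a *\<^sub>C (x + y) = a *\<^sub>C x + a *\<^sub>C y"
    by transfer (simp add: scaleC_add_right)
  show "(a + b) *\<^sub>C x = a *\<^sub>C x + b *\<^sub>C x"
    by transfer (simp add: scaleC_add_left)
  show "a *\<^sub>C (b *\<^sub>C x) = (a * b) *\<^sub>C x"
    by transfer (simp add: scaleC_scaleC)
  show "r *\<^sub>R x = complex_of_real r *\<^sub>C x"
    by transfer (simp add: scaleR_scaleC)
  show "norm (a *\<^sub>C x) = norm a * norm x"
    by transfer (rule onorm_scaleC)
qed

end


section \<open>The circle and its normalized Haar measure\<close>

definition haar :: "complex measure" where
  "haar = distr (restrict_space lborel {0..<1}) (restrict_space borel (sphere 0 1))
            (\<lambda>t. cis (2 * pi * t))"

lemma space_haar [simp]: "space haar = sphere 0 1"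
  by (simp add: haar_def space_restrict_space)

lemma sets_haar [measurable_cong]: "sets haar = sets (restrict_space borel (sphere 0 1))"
  by (simp add: haar_def)

lemma cis_measurable:
  "(\<lambda>t. cis (2 * pi * t)) \<in> restrict_space lborel {0..<1::real} \<rightarrow>\<^sub>M restrict_space borel (sphere 0 1)"
proof (rule measurable_restrict_space2)
  have "(\<lambda>t. cis (2 * pi * t)) \<in> borel_measurable borel"
    by (intro borel_measurable_continuous_onI continuous_intros)
  then show "(\<lambda>t. cis (2 * pi * t)) \<in> borel_measurable (restrict_space lborel {0..<1::real})"
    by (intro measurable_restrict_space1) simp
qed auto

lemma emeasure_haar:
  assumes "A \<in> sets haar"
  shows "emeasure haar A = emeasure lborel ({t. cis (2 * pi * t) \<in> A} \<inter> {0..<1})"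
proof -
  have "emeasure haar A = emeasure (restrict_space lborel {0..<1::real})
      ((\<lambda>t. cis (2 * pi * t)) -` A \<inter> {0..<1})"
    unfolding haar_def using assms
    by (subst emeasure_distr[OF cis_measurable]) (simp_all add: sets_haar space_restrict_space)
  also have "\<dots> = emeasure lborel ((\<lambda>t. cis (2 * pi * t)) -` A \<inter> {0..<1})"
    by (subst emeasure_restrict_space) auto
  finally show ?thesis
    by (simp add: vimage_def)
qed

lemma emeasure_haar_space: "emeasure haar (sphere 0 1) = 1"
  using sets.top[of haar] by (subst emeasure_haar) simp_all

lemma emeasure_lborel_shift:
  fixes S :: "real set"
  assumes "S \<in> sets borel"
  shows "emeasure lborel {t. c + t \<in> S} = emeasure lborel S"
proof -
  have "emeasure lborel S = emeasure (distr lborel borel ((+) c)) S"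
    by (simp add: lborel_distr_plus)
  also have "\<dots> = emeasure lborel {t. c + t \<in> S}"
    using assms by (subst emeasure_distr) (simp_all add: vimage_def)
  finally show ?thesis by simp
qed

lemma measurable_rotation:
  assumes "norm \<mu> = 1"
  shows "(\<lambda>z. \<mu> * z) \<in> haar \<rightarrow>\<^sub>M haar"
proof -
  have "(\<lambda>z. \<mu> * z) \<in> restrict_space borel (sphere 0 1) \<rightarrow>\<^sub>M restrict_space borel (sphere (0::complex) 1)"
    using assms
    by (intro measurable_restrict_space2 measurable_restrict_space1)
       (auto simp: space_restrict_space norm_mult)
  then show ?thesis
    by (simp cong: measurable_cong_sets add: sets_haar)
qed

lemma distr_haar_rotation:
  assumes "norm \<mu> = 1"
  shows "distr haar haar (\<lambda>z. \<mu> * z) = haar"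
proof (rule measure_eqI)
  show "sets (distr haar haar (\<lambda>z. \<mu> * z)) = sets haar"
    by simp
  fix A
  assume "A \<in> sets (distr haar haar (\<lambda>z. \<mu> * z))"
  then have A: "A \<in> sets haar" by simp
  define a where "a = Arg2pi \<mu> / (2 * pi)"
  have a: "0 \<le> a" "a < 1"
    using Arg2pi[of \<mu>] by (auto simp: a_def field_simps)
  have lam: "\<mu> = cis (2 * pi * a)"
    using Arg2pi[of \<mu>] assms by (simp add: a_def cis_conv_exp is_Arg_def)
  define B where "B = {t. cis (2 * pi * t) \<in> A}"
  have "A \<in> sets borel"
    using A by (auto simp: sets_haar sets_restrict_space)
  moreover have "(\<lambda>t. cis (2 * pi * t)) \<in> borel_measurable borel"
    by (intro borel_measurable_continuous_onI continuous_intros)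
  ultimately have B: "B \<in> sets borel"
    unfolding B_def using measurable_sets[of "\<lambda>t. cis (2 * pi * t)" borel borel A]
    by (simp add: vimage_def)
  have B_periodic: "1 + t \<in> B \<longleftrightarrow> t \<in> B" for t
    by (simp add: B_def distrib_left flip: cis_mult)
  have "emeasure (distr haar haar (\<lambda>z. \<mu> * z)) A
      = emeasure haar ((\<lambda>z. \<mu> * z) -` A \<inter> space haar)"
    using A by (rule emeasure_distr[OF measurable_rotation[OF assms]])
  also have "\<dots> = emeasure lborel
      ({t. cis (2 * pi * t) \<in> (\<lambda>z. \<mu> * z) -` A \<inter> space haar} \<inter> {0..<1})"
    by (intro emeasure_haar measurable_sets[OF measurable_rotation[OF assms] A])
  also have "{t. cis (2 * pi * t) \<in> (\<lambda>z. \<mu> * z) -` A \<inter> space haar} \<inter> {0..<1}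
      = {t. a + t \<in> B \<inter> {a..<a+1}}"
    by (auto simp: B_def lam cis_mult distrib_left)
  also have "emeasure lborel \<dots> = emeasure lborel (B \<inter> {a..<a+1})"
    using B by (intro emeasure_lborel_shift) auto
  also have "B \<inter> {a..<a+1} = (B \<inter> {a..<1}) \<union> (B \<inter> {1..<a+1})"
    using a by auto
  also have "emeasure lborel \<dots> = emeasure lborel (B \<inter> {a..<1}) + emeasure lborel (B \<inter> {1..<a+1})"
    using B by (intro plus_emeasure[symmetric]) auto
  also have "emeasure lborel (B \<inter> {1..<a+1}) = emeasure lborel {t. 1 + t \<in> B \<inter> {1..<a+1}}"
    using B by (intro emeasure_lborel_shift[symmetric]) auto
  also have "{t. 1 + t \<in> B \<inter> {1..<a+1}} = B \<inter> {0..<a}"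
    by (auto simp: B_periodic)
  also have "emeasure lborel (B \<inter> {a..<1}) + emeasure lborel (B \<inter> {0..<a})
      = emeasure lborel ((B \<inter> {a..<1}) \<union> (B \<inter> {0..<a}))"
    using B by (intro plus_emeasure) auto
  also have "(B \<inter> {a..<1}) \<union> (B \<inter> {0..<a}) = B \<inter> {0..<1}"
    using a by auto
  also have "emeasure lborel (B \<inter> {0..<1}) = emeasure haar A"
    using A by (simp add: emeasure_haar B_def)
  finally show "emeasure (distr haar haar (\<lambda>z. \<mu> * z)) A = emeasure haar A" .
qed


section \<open>The Hilbert space \<open>L\<^sup>2\<close> of the circle\<close>

definition square_integrable :: "(complex \<Rightarrow> complex) \<Rightarrow> bool" where
  "square_integrable f \<longleftrightarrow> f \<in> borel_measurable haar \<and> integrable haar (\<lambda>z. (norm (f z))\<^sup>2)"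

lemma square_integrable_measurable: "square_integrable f \<Longrightarrow> f \<in> borel_measurable haar"
  by (simp add: square_integrable_def)

lemma square_integrable_add:
  assumes "square_integrable f" "square_integrable g"
  shows "square_integrable (\<lambda>z. f z + g z)"
proof -
  note [measurable] = assms[THEN square_integrable_measurable]
  have "integrable haar (\<lambda>z. (norm (f z + g z))\<^sup>2)"
  proof (rule Bochner_Integration.integrable_bound)
    show "integrable haar (\<lambda>z. 2 * (norm (f z))\<^sup>2 + 2 * (norm (g z))\<^sup>2)"
      using assms by (simp add: square_integrable_def)
    have "(norm (f z + g z))\<^sup>2 \<le> 2 * (norm (f z))\<^sup>2 + 2 * (norm (g z))\<^sup>2" for z
    proof -
      have "(norm (f z + g z))\<^sup>2 \<le> (norm (f z) + norm (g z))\<^sup>2"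
        by (simp add: norm_triangle_ineq power_mono)
      also have "\<dots> \<le> 2 * (norm (f z))\<^sup>2 + 2 * (norm (g z))\<^sup>2"
        using sum_squares_bound[of "norm (f z)" "norm (g z)"] by (simp add: power2_sum)
      finally show ?thesis .
    qed
    then show "AE z in haar. norm ((norm (f z + g z))\<^sup>2)
        \<le> norm (2 * (norm (f z))\<^sup>2 + 2 * (norm (g z))\<^sup>2)"
      by simp
  qed measurable
  then show ?thesis
    by (simp add: square_integrable_def)
qed

lemma square_integrable_cmult:
  assumes "square_integrable f"
  shows "square_integrable (\<lambda>z. c * f z)"
  using assms by (auto simp: square_integrable_def norm_mult power_mult_distrib)

lemma square_integrable_mult_cnj:
  assumes "square_integrable f" "square_integrable g"
  shows "integrable haar (\<lambda>z. f z * cnj (g z))"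
proof (rule Bochner_Integration.integrable_bound)
  note [measurable] = assms[THEN square_integrable_measurable]
  show "integrable haar (\<lambda>z. (norm (f z))\<^sup>2 + (norm (g z))\<^sup>2)"
    using assms by (simp add: square_integrable_def)
  show "(\<lambda>z. f z * cnj (g z)) \<in> borel_measurable haar"
    by (intro borel_measurable_times borel_measurable_continuous_on[of cnj]
        continuous_intros) measurable
  have "norm (f z) * norm (g z) \<le> (norm (f z))\<^sup>2 + (norm (g z))\<^sup>2" for z
    using sum_squares_bound[of "norm (f z)" "norm (g z)"]
      mult_nonneg_nonneg[OF norm_ge_zero norm_ge_zero, of "f z" "g z"] by linarith
  then show "AE z in haar. norm (f z * cnj (g z)) \<le> norm ((norm (f z))\<^sup>2 + (norm (g z))\<^sup>2)"
    by (simp add: norm_mult)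
qed

quotient_type L2 = "complex \<Rightarrow> complex" / partial:
  "\<lambda>f g. square_integrable f \<and> square_integrable g \<and> (AE z in haar. f z = g z)"
proof (rule part_equivpI)
  have "square_integrable (\<lambda>z. 0)"
    by (simp add: square_integrable_def)
  then show "\<exists>f. square_integrable f \<and> square_integrable f \<and> (AE z in haar. f z = f z)"
    by auto
  show "symp (\<lambda>f g. square_integrable f \<and> square_integrable g \<and> (AE z in haar. f z = g z))"
    by (auto intro!: sympI elim: eventually_mono)
  show "transp (\<lambda>f g. square_integrable f \<and> square_integrable g \<and> (AE z in haar. f z = g z))"
    by (rule transpI) (auto elim: eventually_elim2)
qed

instantiation L2 :: real_inner
begin

lift_definition zero_L2 :: L2 is "\<lambda>z. 0"
  by (simp add: square_integrable_def)

lift_definition plus_L2 :: "L2 \<Rightarrow> L2 \<Rightarrow> L2" is "\<lambda>f g z. f z + g z"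
  by (auto simp: square_integrable_add elim: eventually_elim2)

lift_definition uminus_L2 :: "L2 \<Rightarrow> L2" is "\<lambda>f z. - f z"
  by (auto simp: square_integrable_def)

lift_definition scaleR_L2 :: "real \<Rightarrow> L2 \<Rightarrow> L2" is "\<lambda>r f z. r *\<^sub>R f z"
  by (auto simp: square_integrable_cmult scaleR_conv_of_real elim: eventually_mono)

definition minus_L2 :: "L2 \<Rightarrow> L2 \<Rightarrow> L2" where "f - g = f + - g" for f g :: L2

lift_definition norm_L2 :: "L2 \<Rightarrow> real" is "\<lambda>f. sqrt (LINT z|haar. (norm (f z))\<^sup>2)"
  by (intro arg_cong[where f = sqrt] integral_cong_AE) (auto simp: square_integrable_def)

lift_definition inner_L2 :: "L2 \<Rightarrow> L2 \<Rightarrow> real" is "\<lambda>f g. Re (LINT z|haar. f z * cnj (g z))"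
proof (intro arg_cong[where f = Re] integral_cong_AE)
  fix f f' g g' :: "complex \<Rightarrow> complex"
  assume *: "square_integrable f \<and> square_integrable f' \<and> (AE z in haar. f z = f' z)"
    "square_integrable g \<and> square_integrable g' \<and> (AE z in haar. g z = g' z)"
  then show "(\<lambda>z. f z * cnj (g z)) \<in> borel_measurable haar"
    "(\<lambda>z. f' z * cnj (g' z)) \<in> borel_measurable haar"
    by (auto intro!: borel_measurable_integrable square_integrable_mult_cnj)
  from * show "AE z in haar. f z * cnj (g z) = f' z * cnj (g' z)"
    by (auto elim: eventually_elim2)
qed

definition sgn_L2 :: "L2 \<Rightarrow> L2" where "sgn f = inverse (norm f) *\<^sub>R f" for f :: L2

definition dist_L2 :: "L2 \<Rightarrow> L2 \<Rightarrow> real" where "dist f g = norm (f - g)" for f g :: L2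

definition uniformity_L2 :: "(L2 \<times> L2) filter" where
  "uniformity_L2 = (INF e\<in>{0<..}. principal {(x, y). dist x y < e})"

definition open_L2 :: "L2 set \<Rightarrow> bool" where
  "open_L2 U \<longleftrightarrow> (\<forall>x\<in>U. \<forall>\<^sub>F (x', y) in uniformity. x' = x \<longrightarrow> y \<in> U)"

instance
proof
  fix f g h :: L2 and r s :: real
  show "f + g + h = f + (g + h)" 
    by transfer (auto simp: square_integrable_add add.assoc)
  show "f + g = g + f"
    by transfer (auto simp: square_integrable_add add.commute)
  show "0 + f = f"
    by transfer simp
  show "- f + f = 0"
    by transfer (simp add: square_integrable_def)
  show "f - g = f + - g"
    by (rule minus_L2_def)
  show "r *\<^sub>R (f + g) = r *\<^sub>R f + r *\<^sub>R g"
    by transfer (simp add: square_integrable_add square_integrable_cmult scaleR_conv_of_real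
        distrib_left)
  show "(r + s) *\<^sub>R f = r *\<^sub>R f + s *\<^sub>R f"
    by transfer (simp add: square_integrable_add square_integrable_cmult scaleR_conv_of_real
        distrib_right)
  show "r *\<^sub>R s *\<^sub>R f = (r * s) *\<^sub>R f"
    by transfer (simp add: square_integrable_cmult scaleR_conv_of_real mult.assoc)
  show "1 *\<^sub>R f = f"
    by transfer simp
  show "sgn f = inverse (norm f) *\<^sub>R f"
    by (rule sgn_L2_def)
  show "dist f g = norm (f - g)"
    by (rule dist_L2_def)
  show "(uniformity :: (L2 \<times> L2) filter) = (INF e\<in>{0<..}. principal {(x, y). dist x y < e})"
    by (rule uniformity_L2_def)
  show "open U \<longleftrightarrow> (\<forall>x\<in>U. \<forall>\<^sub>F (x', y) in uniformity. x' = x \<longrightarrow> y \<in> U)" for U :: "L2 set"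
    by (rule open_L2_def)
  show "inner f g = inner g f"
  proof transfer
    fix f g
    have "(LINT z|haar. g z * cnj (f z)) = (LINT z|haar. cnj (f z * cnj (g z)))"
      by (simp add: mult.commute)
    also have "\<dots> = cnj (LINT z|haar. f z * cnj (g z))"
      by (rule Bochner_Integration.integral_cnj)
    finally show "Re (LINT z|haar. f z * cnj (g z)) = Re (LINT z|haar. g z * cnj (f z))"
      by simp
  qed
  show "inner (f + g) h = inner f h + inner g h"
    by transfer (simp add: distrib_right Bochner_Integration.integral_add square_integrable_mult_cnj)
  show "inner (r *\<^sub>R f) g = r * inner f g"
    by transfer (simp add: scaleR_conv_of_real mult.assoc)
  have *: "Re (LINT z|haar. f z * cnj (f z)) = (LINT z|haar. (norm (f z))\<^sup>2)" for f
    by (simp add: complex_norm_square[symmetric] del: of_real_power)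
  show "0 \<le> inner f f"
    by transfer (simp add: *)
  show "inner f f = 0 \<longleftrightarrow> f = 0"
    by transfer (subst *, subst integral_nonneg_eq_0_iff_AE, auto simp: square_integrable_def)
  show "norm f = sqrt (inner f f)"
    by transfer (simp add: *)
qed

end

instantiation L2 :: complex_normed_vector
begin

lift_definition scaleC_L2 :: "complex \<Rightarrow> L2 \<Rightarrow> L2" is "\<lambda>c f z. c * f z"
  by (auto simp: square_integrable_cmult elim: eventually_mono)

instance
proof
  fix a b :: complex and r :: real and f g :: L2
  show "a *\<^sub>C (f + g) = a *\<^sub>C f + a *\<^sub>C g"
    by transfer (simp add: square_integrable_add square_integrable_cmult distrib_left)
  show "(a + b) *\<^sub>C f = a *\<^sub>C f + b *\<^sub>C f"
    by transfer (auto simp: square_integrable_add square_integrable_cmult distrib_right)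
  show "a *\<^sub>C (b *\<^sub>C f) = (a * b) *\<^sub>C f"
    by transfer (simp add: square_integrable_cmult mult.assoc)
  show "r *\<^sub>R f = complex_of_real r *\<^sub>C f"
    by transfer (simp add: square_integrable_cmult scaleR_conv_of_real)
  show "norm (a *\<^sub>C f) = norm a * norm f"
    by transfer (simp add: norm_mult power_mult_distrib real_sqrt_mult)
qed

end

lift_definition cinner :: "L2 \<Rightarrow> L2 \<Rightarrow> complex" is "\<lambda>f g. LINT z|haar. f z * cnj (g z)"
proof (intro integral_cong_AE)
  fix f f' g g' :: "complex \<Rightarrow> complex"
  assume *: "square_integrable f \<and> square_integrable f' \<and> (AE z in haar. f z = f' z)"
    "square_integrable g \<and> square_integrable g' \<and> (AE z in haar. g z = g' z)"
  then show "(\<lambda>z. f z * cnj (g z)) \<in> borel_measurable haar"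
    "(\<lambda>z. f' z * cnj (g' z)) \<in> borel_measurable haar"
    by (auto intro!: borel_measurable_integrable square_integrable_mult_cnj)
  from * show "AE z in haar. f z * cnj (g z) = f' z * cnj (g' z)"
    by (auto elim: eventually_elim2)
qed


section \<open>Multiplication operators and rotations\<close>

text \<open>\<open>L2 \<Rightarrow>\<^sub>L L2\<close> consists of the bounded real-linear operators.  The complex-linear ones, that is
  \<open>B(L\<^sup>2)\<close>, form a closed complex subspace with the same norm, so that closed complex linear spans
  of complex-linear operators are the same in both spaces.\<close>

text \<open>Elements of \<open>L\<^sup>\<infinity>\<close> are given by representatives; \<open>mult_op f\<close> below depends only on the
  almost everywhere class of \<open>f\<close>.\<close>

definition Linfty :: "(complex \<Rightarrow> complex) set" where
  "Linfty = {f \<in> borel_measurable haar. \<exists>C. AE z in haar. norm (f z) \<le> C}"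

lemma LinftyE:
  assumes "f \<in> Linfty"
  obtains C where "C \<ge> 0" "AE z in haar. norm (f z) \<le> C"
proof -
  from assms obtain C where C: "AE z in haar. norm (f z) \<le> C"
    by (auto simp: Linfty_def)
  then have "AE z in haar. norm (f z) \<le> max C 0"
    by (rule eventually_mono) simp
  then show ?thesis
    by (rule that[rotated]) simp
qed

lemma square_integrable_mult:
  assumes "f \<in> Linfty" "square_integrable h"
  shows "square_integrable (\<lambda>z. f z * h z)"
proof -
  from assms have [measurable]: "f \<in> borel_measurable haar" "h \<in> borel_measurable haar"
    by (auto simp: Linfty_def square_integrable_def)
  obtain C where C: "C \<ge> 0" "AE z in haar. norm (f z) \<le> C"
    using assms(1) by (rule LinftyE)
  have "integrable haar (\<lambda>z. (norm (f z * h z))\<^sup>2)"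
  proof (rule Bochner_Integration.integrable_bound)
    show "integrable haar (\<lambda>z. C\<^sup>2 * (norm (h z))\<^sup>2)"
      using assms(2) by (simp add: square_integrable_def)
    show "AE z in haar. norm ((norm (f z * h z))\<^sup>2) \<le> norm (C\<^sup>2 * (norm (h z))\<^sup>2)"
      using C(2) by (rule eventually_mono)
        (simp add: norm_mult power_mult_distrib mult_right_mono power_mono)
  qed measurable
  then show ?thesis
    by (simp add: square_integrable_def)
qed

lemma norm_mult_bound:
  assumes "f \<in> Linfty" "C \<ge> 0" "AE z in haar. norm (f z) \<le> C" "square_integrable h"
  shows "sqrt (LINT z|haar. (norm (f z * h z))\<^sup>2) \<le> sqrt (LINT z|haar. (norm (h z))\<^sup>2) * C"
proof -
  have "(LINT z|haar. (norm (f z * h z))\<^sup>2) \<le> (LINT z|haar. C\<^sup>2 * (norm (h z))\<^sup>2)"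
  proof (rule integral_mono_AE)
    show "AE z in haar. (norm (f z * h z))\<^sup>2 \<le> C\<^sup>2 * (norm (h z))\<^sup>2"
      using assms(3) by (rule eventually_mono)
        (simp add: norm_mult power_mult_distrib mult_right_mono power_mono)
  qed (use assms(4) square_integrable_mult[OF assms(1,4)] in \<open>auto simp: square_integrable_def\<close>)
  then have "sqrt (LINT z|haar. (norm (f z * h z))\<^sup>2)
      \<le> sqrt (C\<^sup>2 * (LINT z|haar. (norm (h z))\<^sup>2))"
    by simp
  then show ?thesis
    using assms(2) by (simp add: real_sqrt_mult mult.commute)
qed

lift_definition mult_fun :: "(complex \<Rightarrow> complex) \<Rightarrow> L2 \<Rightarrow> L2" is
  "\<lambda>f h z. if f \<in> Linfty then f z * h z else 0"
proof -
  fix f h h' :: "complex \<Rightarrow> complex"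
  assume *: "square_integrable h \<and> square_integrable h' \<and> (AE z in haar. h z = h' z)"
  show "square_integrable (\<lambda>z. if f \<in> Linfty then f z * h z else 0) \<and>
    square_integrable (\<lambda>z. if f \<in> Linfty then f z * h' z else 0) \<and>
    (AE z in haar. (if f \<in> Linfty then f z * h z else 0) = (if f \<in> Linfty then f z * h' z else 0))"
  proof (cases "f \<in> Linfty")
    case True
    with * show ?thesis
      by (auto simp: square_integrable_mult elim: eventually_mono)
  next
    case False
    then show ?thesis
      by (simp add: square_integrable_def)
  qed
qed

lift_definition mult_op :: "(complex \<Rightarrow> complex) \<Rightarrow> L2 \<Rightarrow>\<^sub>L L2" is mult_fun
proof -
  fix f
  show "bounded_linear (mult_fun f)"
  proof (cases "f \<in> Linfty")
    case True
    obtain C where C: "C \<ge> 0" "AE z in haar. norm (f z) \<le> C"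
      using True by (rule LinftyE)
    show ?thesis
    proof (rule bounded_linear_intro[where K = C])
      show "mult_fun f (g + h) = mult_fun f g + mult_fun f h" for g h
        using True
        by transfer (simp add: square_integrable_add square_integrable_mult distrib_left)
      show "mult_fun f (r *\<^sub>R h) = r *\<^sub>R mult_fun f h" for r h
        using True
        by transfer (simp add: square_integrable_cmult square_integrable_mult
            scaleR_conv_of_real mult.left_commute)
      show "norm (mult_fun f h) \<le> norm h * C" for h
        using True C by (transfer fixing: f C) (simp add: norm_mult_bound)
    qed
  next
    case False
    then have "mult_fun f = (\<lambda>h. 0)"
      by (intro ext, transfer) (simp add: square_integrable_def)
    then show ?thesis
      by (simp add: bounded_linear_zero)
  qed
qed

lemma AE_haar_rotation:
  assumes "norm \<mu> = 1" "AE z in haar. Q z"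
  shows "AE z in haar. Q (\<mu> * z)"
proof -
  have "AE z in distr haar haar (\<lambda>z. \<mu> * z). Q z"
    using assms(2) by (simp only: distr_haar_rotation[OF assms(1)])
  then show ?thesis
    using assms(1) by (auto dest: AE_distrD[OF measurable_rotation])
qed

lemma borel_measurable_rotation:
  assumes "norm \<mu> = 1" "h \<in> borel_measurable haar"
  shows "(\<lambda>z. h (\<mu> * z)) \<in> borel_measurable haar"
  using measurable_rotation[OF assms(1)] assms(2) by (rule measurable_compose)

lemma integral_rotation:
  fixes h :: "complex \<Rightarrow> real"
  assumes "norm \<mu> = 1" "h \<in> borel_measurable haar"
  shows "(LINT z|haar. h (\<mu> * z)) = (LINT z|haar. h z)"
    and "integrable haar (\<lambda>z. h (\<mu> * z)) \<longleftrightarrow> integrable haar h"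
  using integral_distr[OF measurable_rotation[OF assms(1)] assms(2)]
    integrable_distr_eq[OF measurable_rotation[OF assms(1)] assms(2)]
  by (simp_all add: distr_haar_rotation assms(1))

lemma square_integrable_rotation:
  assumes "norm \<mu> = 1" "square_integrable h"
  shows "square_integrable (\<lambda>z. h (\<mu> * z))"
proof -
  from assms(2) have [measurable]: "h \<in> borel_measurable haar"
    by (rule square_integrable_measurable)
  have "(\<lambda>z. (norm (h z))\<^sup>2) \<in> borel_measurable haar"
    by measurable
  from integral_rotation(2)[OF assms(1) this] show ?thesis
    using assms by (simp add: square_integrable_def borel_measurable_rotation)
qed

lemma norm_rotation:
  assumes "norm \<mu> = 1" "square_integrable h"
  shows "(LINT z|haar. (norm (h (\<mu> * z)))\<^sup>2) = (LINT z|haar. (norm (h z))\<^sup>2)"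
proof -
  from assms(2) have [measurable]: "h \<in> borel_measurable haar"
    by (rule square_integrable_measurable)
  have "(\<lambda>z. (norm (h z))\<^sup>2) \<in> borel_measurable haar"
    by measurable
  from integral_rotation(1)[OF assms(1) this] show ?thesis .
qed

lift_definition rot_fun :: "complex \<Rightarrow> L2 \<Rightarrow> L2" is
  "\<lambda>\<mu> h z. if norm \<mu> = 1 then h (\<mu> * z) else 0"
proof -
  fix \<mu> :: complex and h h' :: "complex \<Rightarrow> complex"
  assume *: "square_integrable h \<and> square_integrable h' \<and> (AE z in haar. h z = h' z)"
  show "square_integrable (\<lambda>z. if norm \<mu> = 1 then h (\<mu> * z) else 0) \<and>
    square_integrable (\<lambda>z. if norm \<mu> = 1 then h' (\<mu> * z) else 0) \<and>
    (AE z in haar. (if norm \<mu> = 1 then h (\<mu> * z) else 0) = (if norm \<mu> = 1 then h' (\<mu> * z) else 0))"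
  proof (cases "norm \<mu> = 1")
    case True
    with * show ?thesis
      using AE_haar_rotation[of \<mu> "\<lambda>z. h z = h' z"] by (simp add: square_integrable_rotation)
  next
    case False
    then show ?thesis
      by (simp add: square_integrable_def)
  qed
qed

lift_definition rot_op :: "complex \<Rightarrow> L2 \<Rightarrow>\<^sub>L L2" is rot_fun
proof -
  fix \<mu>
  show "bounded_linear (rot_fun \<mu>)"
  proof (cases "norm \<mu> = 1")
    case True
    show ?thesis
    proof (rule bounded_linear_intro[where K = 1])
      show "rot_fun \<mu> (g + h) = rot_fun \<mu> g + rot_fun \<mu> h" for g h
        using True by transfer (simp add: square_integrable_add square_integrable_rotation)
      show "rot_fun \<mu> (r *\<^sub>R h) = r *\<^sub>R rot_fun \<mu> h" for r h
        using True by transfer (simp add: square_integrable_cmult square_integrable_rotation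
            scaleR_conv_of_real)
      show "norm (rot_fun \<mu> h) \<le> norm h * 1" for h
        using True by (transfer fixing: \<mu>) (simp add: norm_rotation)
    qed
  next
    case False
    then have "rot_fun \<mu> = (\<lambda>h. 0)"
      by (intro ext, transfer) (simp add: square_integrable_def)
    then show ?thesis
      by (simp add: bounded_linear_zero)
  qed
qed


section \<open>The Hardy space and \<open>\<lambda>\<close>-Toeplitz operators\<close>

lemma square_integrable_powi: "square_integrable (\<lambda>z. z powi n)"
proof -
  have "continuous_on (sphere 0 1) (\<lambda>z :: complex. z powi n)"
    by (intro continuous_intros) auto
  then have "(\<lambda>z. z powi n) \<in> borel_measurable (restrict_space borel (sphere (0 :: complex) 1))"
    by (rule borel_measurable_continuous_on_restrict)
  then have "(\<lambda>z. z powi n) \<in> borel_measurable haar"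
    by (simp cong: measurable_cong_sets add: sets_haar)
  moreover have "integrable haar (\<lambda>z. (norm (z powi n))\<^sup>2) \<longleftrightarrow> integrable haar (\<lambda>z. 1 :: real)"
    by (intro Bochner_Integration.integrable_cong) (auto simp: norm_power_int)
  moreover have "finite_measure haar"
    by (rule finite_measureI) (simp add: emeasure_haar_space)
  ultimately show ?thesis
    by (simp add: square_integrable_def finite_measure.integrable_const)
qed

lift_definition zpow :: "int \<Rightarrow> L2" is "\<lambda>n z. z powi n"
  by (simp add: square_integrable_powi)

definition hardy :: "L2 set" where
  "hardy = closure (complex_vector.span {zpow n |n. 0 \<le> n})"

lemma hardy_add:
  assumes "x \<in> hardy" "y \<in> hardy"
  shows "x + y \<in> hardy"
proof -
  let ?S = "complex_vector.span {zpow n |n. 0 \<le> n}"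
  obtain u v where "\<forall>k. u k \<in> ?S" "u \<longlonglongrightarrow> x" "\<forall>k. v k \<in> ?S" "v \<longlonglongrightarrow> y"
    using assms unfolding hardy_def closure_sequential by auto
  then have "(\<forall>k. u k + v k \<in> ?S) \<and> (\<lambda>k. u k + v k) \<longlonglongrightarrow> x + y"
    by (simp add: complex_vector.span_add tendsto_add)
  then show ?thesis
    unfolding hardy_def closure_sequential by (intro exI[of _ "\<lambda>k. u k + v k"])
qed

lemma hardy_scaleC:
  assumes "x \<in> hardy"
  shows "c *\<^sub>C x \<in> hardy"
proof -
  let ?S = "complex_vector.span {zpow n |n. 0 \<le> n}"
  obtain u where "\<forall>k. u k \<in> ?S" "u \<longlonglongrightarrow> x"
    using assms unfolding hardy_def closure_sequential by auto
  then have "(\<forall>k. c *\<^sub>C u k \<in> ?S) \<and> (\<lambda>k. c *\<^sub>C u k) \<longlonglongrightarrow> c *\<^sub>C x"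
    by (simp add: complex_vector.span_scale bounded_linear.tendsto[OF bounded_linear_scaleC])
  then show ?thesis
    unfolding hardy_def closure_sequential by (intro exI[of _ "\<lambda>k. c *\<^sub>C u k"])
qed

lemma hardy_zero: "0 \<in> hardy"
  unfolding hardy_def by (intro subsetD[OF closure_subset] complex_vector.span_zero)

lemma hardy_scaleR: "x \<in> hardy \<Longrightarrow> r *\<^sub>R x \<in> hardy"
  by (simp add: scaleR_scaleC hardy_scaleC)

lemma hardy_uminus: "x \<in> hardy \<Longrightarrow> - x \<in> hardy"
  using hardy_scaleR[of x "-1"] by simp

lemma hardy_diff: "x \<in> hardy \<Longrightarrow> y \<in> hardy \<Longrightarrow> x - y \<in> hardy"
  using hardy_add[of x "- y"] by (simp add: hardy_uminus)

typedef H2 = hardy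
  using hardy_zero by blast

instantiation H2 :: real_normed_vector
begin

definition zero_H2 :: H2 where "0 = Abs_H2 0"
definition plus_H2 :: "H2 \<Rightarrow> H2 \<Rightarrow> H2" where "x + y = Abs_H2 (Rep_H2 x + Rep_H2 y)"
definition minus_H2 :: "H2 \<Rightarrow> H2 \<Rightarrow> H2" where "x - y = Abs_H2 (Rep_H2 x - Rep_H2 y)"
definition uminus_H2 :: "H2 \<Rightarrow> H2" where "- x = Abs_H2 (- Rep_H2 x)"
definition scaleR_H2 :: "real \<Rightarrow> H2 \<Rightarrow> H2" where "r *\<^sub>R x = Abs_H2 (r *\<^sub>R Rep_H2 x)"
definition norm_H2 :: "H2 \<Rightarrow> real" where "norm x = norm (Rep_H2 x)"
definition sgn_H2 :: "H2 \<Rightarrow> H2" where "sgn x = inverse (norm x) *\<^sub>R x" for x :: H2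
definition dist_H2 :: "H2 \<Rightarrow> H2 \<Rightarrow> real" where "dist x y = norm (x - y)" for x y :: H2
definition uniformity_H2 :: "(H2 \<times> H2) filter" where
  "uniformity_H2 = (INF e\<in>{0<..}. principal {(x, y). dist x y < e})"
definition open_H2 :: "H2 set \<Rightarrow> bool" where
  "open_H2 U \<longleftrightarrow> (\<forall>x\<in>U. \<forall>\<^sub>F (x', y) in uniformity. x' = x \<longrightarrow> y \<in> U)"

lemma Rep_H2_simps:
  "Rep_H2 0 = 0" "Rep_H2 (x + y) = Rep_H2 x + Rep_H2 y" "Rep_H2 (x - y) = Rep_H2 x - Rep_H2 y"
  "Rep_H2 (- x) = - Rep_H2 x" "Rep_H2 (r *\<^sub>R x) = r *\<^sub>R Rep_H2 x"
  unfolding zero_H2_def plus_H2_def minus_H2_def uminus_H2_def scaleR_H2_def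
  by (intro Abs_H2_inverse hardy_zero hardy_add hardy_diff hardy_uminus hardy_scaleR Rep_H2)+

instance
proof
  fix x y z :: H2 and r s :: real
  show "x + y + z = x + (y + z)" "x + y = y + x" "0 + x = x" "- x + x = 0" "x - y = x + - y"
    by (simp_all only: Rep_H2_simps ac_simps add_0 add.right_inverse diff_conv_add_uminus
        flip: Rep_H2_inject)
  show "r *\<^sub>R (x + y) = r *\<^sub>R x + r *\<^sub>R y" "(r + s) *\<^sub>R x = r *\<^sub>R x + s *\<^sub>R x"
    "r *\<^sub>R s *\<^sub>R x = (r * s) *\<^sub>R x" "1 *\<^sub>R x = x"
    by (simp_all only: Rep_H2_simps scaleR_add_right scaleR_add_left scaleR_scaleR scaleR_one
        flip: Rep_H2_inject)
  show "norm (r *\<^sub>R x) = \<bar>r\<bar> * norm x"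
    by (simp only: norm_H2_def Rep_H2_simps norm_scaleR)
  show "norm (x + y) \<le> norm x + norm y"
    by (simp only: norm_H2_def Rep_H2_simps norm_triangle_ineq)
  show "norm x = 0 \<longleftrightarrow> x = 0"
    by (simp only: norm_H2_def Rep_H2_simps norm_eq_zero flip: Rep_H2_inject)
  show "sgn x = inverse (norm x) *\<^sub>R x"
    by (rule sgn_H2_def)
  show "dist x y = norm (x - y)"
    by (rule dist_H2_def)
  show "(uniformity :: (H2 \<times> H2) filter) = (INF e\<in>{0<..}. principal {(x, y). dist x y < e})"
    by (rule uniformity_H2_def)
  show "open U \<longleftrightarrow> (\<forall>x\<in>U. \<forall>\<^sub>F (x', y) in uniformity. x' = x \<longrightarrow> y \<in> U)" for U :: "H2 set"
    by (rule open_H2_def)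
qed

end

instantiation H2 :: complex_normed_vector
begin

definition scaleC_H2 :: "complex \<Rightarrow> H2 \<Rightarrow> H2" where "c *\<^sub>C x = Abs_H2 (c *\<^sub>C Rep_H2 x)"

lemma Rep_H2_scaleC: "Rep_H2 (c *\<^sub>C x) = c *\<^sub>C Rep_H2 x"
  unfolding scaleC_H2_def by (intro Abs_H2_inverse hardy_scaleC Rep_H2)

instance
proof
  fix a b :: complex and r :: real and x y :: H2
  show "a *\<^sub>C (x + y) = a *\<^sub>C x + a *\<^sub>C y" "(a + b) *\<^sub>C x = a *\<^sub>C x + b *\<^sub>C x"
    "a *\<^sub>C (b *\<^sub>C x) = (a * b) *\<^sub>C x" "r *\<^sub>R x = complex_of_real r *\<^sub>C x"
    by (simp_all only: Rep_H2_simps Rep_H2_scaleC scaleC_add_right scaleC_add_left scaleC_scaleC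
        scaleR_scaleC flip: Rep_H2_inject)
  show "norm (a *\<^sub>C x) = norm a * norm x"
    by (simp only: norm_H2_def Rep_H2_scaleC norm_scaleC)
qed

end

text \<open>The orthogonal projection \<open>P\<close> of \<open>L\<^sup>2\<close> onto \<open>H\<^sup>2\<close>; it exists since \<open>L\<^sup>2\<close> is complete.\<close>

definition hardy_proj :: "L2 \<Rightarrow>\<^sub>L L2" where
  "hardy_proj = (THE Q :: L2 \<Rightarrow>\<^sub>L L2. \<forall>h. Q h \<in> hardy \<and> (\<forall>g\<in>hardy. cinner (h - Q h) g = 0))"

definition toeplitz :: "complex \<Rightarrow> (complex \<Rightarrow> complex) \<Rightarrow> H2 \<Rightarrow>\<^sub>L H2" where
  "toeplitz \<mu> f = Blinfun (\<lambda>h. Abs_H2 (hardy_proj (mult_op f (rot_op \<mu> (Rep_H2 h)))))"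

end

theory Submission
  imports Defs
begin

text \<open>
  Write \<open>S\<^sub>k\<close> for multiplication by \<open>z\<^sup>k\<close> and \<open>P\<close> for the projection onto \<open>H\<^sup>2\<close>.  Since \<open>P\<close> is a
  contraction, \<open>\<parallel>PXP\<parallel> \<le> \<parallel>X\<parallel>\<close>.  The converse inequality is obtained by pushing vectors far into
  \<open>H\<^sup>2\<close> with \<open>S\<^sub>k\<close>, an isometry, and rests on two asymptotic facts.

  \<^item> \<open>P S\<^sub>k g - S\<^sub>k g\<close> tends to \<open>0\<close> for every \<open>g\<close> in \<open>L\<^sup>2\<close>, because this difference is eventually zero
    for trigonometric polynomials and these are dense (\<open>hardy_proj_shift_tendsto\<close>,
    \<open>trig_dense\<close>).

  \<^item> \<open>M\<^sub>f V\<^sub>\<mu> S\<^sub>k = \<mu>\<^sup>k S\<^sub>k M\<^sub>f V\<^sub>\<mu>\<close>, so that a linear combination \<open>X\<close> of such operators nearly commutes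
    with \<open>S\<^sub>k\<close> whenever all the finitely many powers \<open>\<mu>\<^sup>k\<close> are near \<open>1\<close>.  By simultaneous Dirichlet
    approximation this happens for arbitrarily large \<open>k\<close>.

  The times \<open>k\<close> of the second fact are packaged into one filter on the natural numbers, which is
  finer than \<open>sequentially\<close> and along which \<open>\<mu>\<^sup>k\<close> tends to \<open>1\<close> for all \<open>\<mu>\<close> of modulus one at once
  (\<open>exists_recurrence_filter\<close>).  Along this filter \<open>PXP S\<^sub>k h - S\<^sub>k X h\<close> tends to \<open>0\<close>, hence
  \<open>\<parallel>X h\<parallel> = \<parallel>S\<^sub>k X h\<parallel> \<le> \<parallel>PXP\<parallel> \<parallel>h\<parallel>\<close> in the limit (\<open>norm_le_norm_compression\<close>).  Both sides of
  \<open>\<parallel>PXP\<parallel> = \<parallel>X\<parallel>\<close> are continuous in \<open>X\<close>, which gives the closed span.  A combination of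
  \<open>\<lambda>\<close>-Toeplitz operators is the restriction of \<open>PX\<close> to \<open>H\<^sup>2\<close>, and has the norm of \<open>PXP\<close>.

  The projection \<open>P\<close> is given by a definite description, so its existence has to be shown:
  \<open>L\<^sup>2\<close> is complete (\<open>L2_complete\<close>), and complete subspaces of inner product spaces have orthogonal
  projections (\<open>orthogonal_projection_exists\<close>).
\<close>

section \<open>Representatives of square integrable functions\<close>

lemma L2_eq_iff:
  assumes "square_integrable f" "square_integrable g"
  shows "abs_L2 f = abs_L2 g \<longleftrightarrow> (AE z in haar. f z = g z)"
  using assms Quotient_rel[OF Quotient_L2, of f g] by auto

lemma L2_cases:
  obtains f where "square_integrable f" "h = abs_L2 f"
  by (induction h rule: L2.abs_induct) auto

lemma abs_L2_ops:
  assumes "square_integrable f" "square_integrable g"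
  shows "abs_L2 f + abs_L2 g = abs_L2 (\<lambda>z. f z + g z)"
    and "abs_L2 f - abs_L2 g = abs_L2 (\<lambda>z. f z - g z)"
  using assms square_integrable_cmult[of g "-1"]
  by (simp_all add: minus_L2_def plus_L2.abs_eq uminus_L2.abs_eq)

lemma scaleC_abs_L2:
  assumes "square_integrable f"
  shows "c *\<^sub>C abs_L2 f = abs_L2 (\<lambda>z. c * f z)"
  using assms by (simp add: scaleC_L2.abs_eq)

lemma norm_abs_L2:
  assumes "square_integrable f"
  shows "norm (abs_L2 f) = sqrt (LINT z|haar. (norm (f z))\<^sup>2)"
  using assms by (simp add: norm_L2.abs_eq)

lemma mult_op_abs_L2:
  assumes "f \<in> Linfty" "square_integrable h"
  shows "mult_op f (abs_L2 h) = abs_L2 (\<lambda>z. f z * h z)"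
  using assms by (simp add: mult_op.rep_eq mult_fun.abs_eq)

lemma rot_op_abs_L2:
  assumes "norm \<mu> = 1" "square_integrable h"
  shows "rot_op \<mu> (abs_L2 h) = abs_L2 (\<lambda>z. h (\<mu> * z))"
  using assms by (simp add: rot_op.rep_eq rot_fun.abs_eq)

lemma square_integrable_diff:
  assumes "square_integrable f" "square_integrable g"
  shows "square_integrable (\<lambda>z. f z - g z)"
  using square_integrable_add[OF assms(1) square_integrable_cmult[OF assms(2), of "-1"]] by simp

lemma L2_dominated_convergence:
  fixes s :: "nat \<Rightarrow> complex \<Rightarrow> complex"
  assumes f: "square_integrable f" and w: "square_integrable w"
    and s: "\<And>n. square_integrable (s n)"
    and lim: "AE z in haar. (\<lambda>n. s n z) \<longlonglongrightarrow> f z"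
    and bound: "\<And>n. AE z in haar. norm (s n z) \<le> norm (w z)"
  shows "(\<lambda>n. abs_L2 (s n)) \<longlonglongrightarrow> abs_L2 f"
proof -
  note [measurable] = assms(1-3)[THEN square_integrable_measurable]
  have "(\<lambda>n. LINT z|haar. (norm (s n z - f z))\<^sup>2) \<longlonglongrightarrow> (LINT z|haar. 0)"
  proof (rule integral_dominated_convergence)
    show "integrable haar (\<lambda>z. 2 * (norm (w z))\<^sup>2 + 2 * (norm (f z))\<^sup>2)"
      using f w by (simp add: square_integrable_def)
    show "AE z in haar. (\<lambda>n. (norm (s n z - f z))\<^sup>2) \<longlonglongrightarrow> 0"
      using lim
    proof (rule eventually_mono)
      fix z assume "(\<lambda>n. s n z) \<longlonglongrightarrow> f z"
      then have "(\<lambda>n. (norm (s n z - f z))\<^sup>2) \<longlonglongrightarrow> (norm (f z - f z))\<^sup>2"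
        by (intro tendsto_intros)
      then show "(\<lambda>n. (norm (s n z - f z))\<^sup>2) \<longlonglongrightarrow> 0" by simp
    qed
    show "AE z in haar. norm ((norm (s n z - f z))\<^sup>2)
        \<le> 2 * (norm (w z))\<^sup>2 + 2 * (norm (f z))\<^sup>2" for n
      using bound[of n]
    proof (rule eventually_mono)
      fix z assume *: "norm (s n z) \<le> norm (w z)"
      have "(norm (s n z - f z))\<^sup>2 \<le> (norm (s n z) + norm (f z))\<^sup>2"
        by (simp add: norm_triangle_ineq4 power_mono)
      also have "\<dots> \<le> (norm (w z) + norm (f z))\<^sup>2"
        using * by (simp add: power_mono)
      also have "\<dots> \<le> 2 * (norm (w z))\<^sup>2 + 2 * (norm (f z))\<^sup>2"
        using sum_squares_bound[of "norm (w z)" "norm (f z)"] by (simp add: power2_sum)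
      finally show "norm ((norm (s n z - f z))\<^sup>2)
        \<le> 2 * (norm (w z))\<^sup>2 + 2 * (norm (f z))\<^sup>2" by simp
    qed
  qed measurable
  then have "(\<lambda>n. sqrt (LINT z|haar. (norm (s n z - f z))\<^sup>2)) \<longlonglongrightarrow> sqrt 0"
    by (intro tendsto_intros) simp
  then have "(\<lambda>n. norm (abs_L2 (s n) - abs_L2 f)) \<longlonglongrightarrow> 0"
    using f s by (simp add: abs_L2_ops norm_abs_L2 square_integrable_diff)
  then show ?thesis
    using Lim_null tendsto_norm_zero_iff by blast
qed

section \<open>Completeness of \<open>L\<^sup>2\<close>\<close>

lemma finite_measure_haar: "finite_measure haar"
  by (rule finite_measureI) (simp add: emeasure_haar_space)

lemma nn_integral_square:
  assumes "square_integrable f"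
  shows "(\<integral>\<^sup>+z. ennreal ((norm (f z))\<^sup>2) \<partial>haar) = ennreal ((norm (abs_L2 f))\<^sup>2)"
  using assms by (subst nn_integral_eq_integral) (auto simp: square_integrable_def norm_abs_L2)

text \<open>The circle has measure one, so by Cauchy--Schwarz the \<open>L\<^sup>1\<close> norm is dominated by the \<open>L\<^sup>2\<close> norm.
  This makes a fast Cauchy sequence converge almost everywhere.\<close>

lemma nn_integral_norm_le:
  assumes "square_integrable f"
  shows "(\<integral>\<^sup>+z. ennreal (norm (f z)) \<partial>haar) \<le> ennreal (norm (abs_L2 f))"
proof -
  note [measurable] = assms[THEN square_integrable_measurable]
  have int: "integrable haar (\<lambda>z. norm (f z))"
    by (rule finite_measure.square_integrable_imp_integrable[OF finite_measure_haar])
       (use assms in \<open>auto simp: square_integrable_def\<close>)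
  have "(\<integral>\<^sup>+z. ennreal (norm (f z)) * 1 \<partial>haar)\<^sup>2
      \<le> (\<integral>\<^sup>+z. (ennreal (norm (f z)))\<^sup>2 \<partial>haar) * (\<integral>\<^sup>+z. 1\<^sup>2 \<partial>haar)"
    by (rule Cauchy_Schwarz_nn_integral) measurable
  then have "(ennreal (LINT z|haar. norm (f z)))\<^sup>2 \<le> ennreal ((norm (abs_L2 f))\<^sup>2)"
    using int by (simp add: nn_integral_eq_integral nn_integral_square[OF assms] ennreal_power
        emeasure_haar_space)
  then have "(LINT z|haar. norm (f z))\<^sup>2 \<le> (norm (abs_L2 f))\<^sup>2"
    by (simp add: ennreal_power)
  then have "(LINT z|haar. norm (f z)) \<le> norm (abs_L2 f)"
    by (rule power2_le_imp_le) simp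
  then show ?thesis
    using int by (simp add: nn_integral_eq_integral)
qed

text \<open>The Riesz--Fischer argument: a subsequence whose increments have norms at most \<open>2\<^sup>-\<^sup>n\<close> has an almost
  everywhere absolutely convergent telescoping series, and Fatou's lemma turns its pointwise limit
  into the limit in norm of the whole sequence.\<close>

lemma L2_complete: "complete (UNIV :: L2 set)"
proof (rule completeI)
  fix X :: "nat \<Rightarrow> L2"
  assume "Cauchy X"
  then have "\<exists>M. \<forall>i\<ge>M. \<forall>j\<ge>M. norm (X i - X j) < (1/2) ^ n" for n
    by (rule CauchyD) simp
  then obtain N where N: "\<And>n i j. i \<ge> N n \<Longrightarrow> j \<ge> N n \<Longrightarrow> norm (X i - X j) < (1/2) ^ n"
    by metis
  \<comment> \<open>Partial sums, instead of \<open>N\<close> itself, give indices that increase with \<open>n\<close>.\<close>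
  define r where "r n = (\<Sum>k\<le>n. N k)" for n
  have r: "N k \<le> r n" if "k \<le> n" for k n
    unfolding r_def using that by (intro member_le_sum) auto
  have "\<forall>n. \<exists>f. square_integrable f \<and> X n = abs_L2 f"
    using L2_cases by metis
  then obtain u where u: "\<And>n. square_integrable (u n)" "\<And>n. X n = abs_L2 (u n)"
    by metis
  note [measurable] = u(1)[THEN square_integrable_measurable]
  define d where "d n z = u (r (Suc n)) z - u (r n) z" for n z
  have d: "square_integrable (d n)" for n
    unfolding d_def by (intro square_integrable_diff u)
  note [measurable] = d[THEN square_integrable_measurable]
  have "norm (abs_L2 (d n)) \<le> (1/2) ^ n" for n
  proof -
    have "abs_L2 (d n) = X (r (Suc n)) - X (r n)"
      unfolding d_def u(2) by (simp add: abs_L2_ops u(1))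
    then show ?thesis
      using N[of n "r (Suc n)" "r n"] r by simp
  qed
  then have "(\<integral>\<^sup>+z. ennreal (norm (d n z)) \<partial>haar) \<le> ennreal ((1/2) ^ n)" for n
    using nn_integral_norm_le[OF d[of n]] by (meson ennreal_leI order_trans)
  then have "(\<integral>\<^sup>+z. (\<Sum>n. ennreal (norm (d n z))) \<partial>haar) \<le> (\<Sum>n. ennreal ((1/2) ^ n))"
    by (subst nn_integral_suminf) (auto intro!: suminf_le)
  also have "\<dots> < \<infinity>"
    by (subst suminf_ennreal2) (auto intro!: summable_geometric)
  finally have "AE z in haar. (\<Sum>n. ennreal (norm (d n z))) \<noteq> \<infinity>"
    by (intro nn_integral_PInf_AE) auto
  then have lim: "AE z in haar. (\<lambda>n. u (r n) z) \<longlonglongrightarrow> lim (\<lambda>n. u (r n) z)"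
  proof (rule eventually_mono)
    fix z assume "(\<Sum>n. ennreal (norm (d n z))) \<noteq> \<infinity>"
    then have "summable (\<lambda>n. norm (d n z))"
      by (intro summable_suminf_not_top) auto
    then have "summable (\<lambda>n. d n z)"
      by (rule summable_norm_cancel)
    then have "convergent (\<lambda>n. \<Sum>i<n. d i z)"
      by (simp add: summable_iff_convergent)
    moreover have "(\<Sum>i<n. d i z) = u (r n) z - u (r 0) z" for n
      unfolding d_def by (rule sum_lessThan_telescope)
    ultimately have "convergent (\<lambda>n. u (r n) z)"
      by (simp add: convergent_diff_const_right_iff)
    then show "(\<lambda>n. u (r n) z) \<longlonglongrightarrow> lim (\<lambda>n. u (r n) z)"
      by (simp add: convergent_LIMSEQ_iff)
  qed
  define g where "g z = lim (\<lambda>n. u (r n) z)" for z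
  have g_meas [measurable]: "g \<in> borel_measurable haar"
    unfolding g_def by (rule borel_measurable_lim_metric) measurable
  have fatou: "(\<integral>\<^sup>+z. ennreal ((norm (u i z - g z))\<^sup>2) \<partial>haar) \<le> ennreal (((1/2) ^ k)\<^sup>2)"
    if "i \<ge> N k" for i k
  proof -
    have "(\<integral>\<^sup>+z. ennreal ((norm (u i z - g z))\<^sup>2) \<partial>haar)
        = (\<integral>\<^sup>+z. liminf (\<lambda>m. ennreal ((norm (u i z - u (r m) z))\<^sup>2)) \<partial>haar)"
    proof (rule nn_integral_cong_AE, use lim in \<open>rule eventually_mono\<close>)
      fix z assume "(\<lambda>n. u (r n) z) \<longlonglongrightarrow> lim (\<lambda>n. u (r n) z)"
      then have "(\<lambda>m. ennreal ((norm (u i z - u (r m) z))\<^sup>2))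
          \<longlonglongrightarrow> ennreal ((norm (u i z - g z))\<^sup>2)"
        unfolding g_def by (intro tendsto_intros)
      then show "ennreal ((norm (u i z - g z))\<^sup>2)
          = liminf (\<lambda>m. ennreal ((norm (u i z - u (r m) z))\<^sup>2))"
        by (intro lim_imp_Liminf[symmetric]) simp_all
    qed
    also have "\<dots> \<le> liminf (\<lambda>m. \<integral>\<^sup>+z. ennreal ((norm (u i z - u (r m) z))\<^sup>2) \<partial>haar)"
      by (rule nn_integral_liminf) measurable
    also have "\<dots> \<le> limsup (\<lambda>m. \<integral>\<^sup>+z. ennreal ((norm (u i z - u (r m) z))\<^sup>2) \<partial>haar)"
      by (rule Liminf_le_Limsup) simp
    also have "\<dots> \<le> ennreal (((1/2) ^ k)\<^sup>2)"
    proof (rule Limsup_bounded, rule eventually_sequentiallyI[of k])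
      fix m assume "k \<le> m"
      then have "norm (X i - X (r m)) \<le> (1/2) ^ k"
        using N[of k i "r m"] that r[of k m] by simp
      then show "(\<integral>\<^sup>+z. ennreal ((norm (u i z - u (r m) z))\<^sup>2) \<partial>haar) \<le> ennreal (((1/2) ^ k)\<^sup>2)"
        using u by (simp add: nn_integral_square square_integrable_diff abs_L2_ops power_mono
            ennreal_leI del: ennreal_power)
    qed
    finally show ?thesis .
  qed
  have ui: "square_integrable (\<lambda>z. u i z - g z)" if "i \<ge> N k" for i k
  proof -
    have "(\<integral>\<^sup>+z. ennreal (norm ((norm (u i z - g z))\<^sup>2)) \<partial>haar) < \<infinity>"
      using fatou[OF that] by (simp add: order_le_less_trans)
    then show ?thesis
      unfolding square_integrable_def by (auto intro!: integrableI_bounded)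
  qed
  \<comment> \<open>The limit is square integrable as a difference of two square integrable functions.\<close>
  have "square_integrable (\<lambda>z. u (N 0) z - (u (N 0) z - g z))"
    by (intro square_integrable_diff u ui[of 0]) simp
  then have g: "square_integrable g" by simp
  have "X \<longlonglongrightarrow> abs_L2 g"
  proof (rule LIMSEQ_I)
    fix e :: real assume "e > 0"
    then obtain k where k: "(1/2) ^ k < e"
      using real_arch_pow_inv[of e "1/2"] by auto
    show "\<exists>no. \<forall>n\<ge>no. norm (X n - abs_L2 g) < e"
    proof (intro exI allI impI)
      fix n assume n: "n \<ge> N k"
      have "(norm (X n - abs_L2 g))\<^sup>2 \<le> ((1/2) ^ k)\<^sup>2"
        using fatou[OF n] ui[OF n] g u by (simp add: abs_L2_ops nn_integral_square)
      then have "norm (X n - abs_L2 g) \<le> (1/2) ^ k"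
        by (rule power2_le_imp_le) simp
      with k show "norm (X n - abs_L2 g) < e" by simp
    qed
  qed
  then show "\<exists>l\<in>UNIV. X \<longlonglongrightarrow> l" by blast
qed

section \<open>Orthogonal projections\<close>

text \<open>The nearest point of \<open>M\<close> to \<open>x\<close>: the parallelogram law makes every minimizing sequence Cauchy, and
  moving from the minimizer along \<open>m\<close> cannot decrease the distance, which forces orthogonality.\<close>

lemma orthogonal_projection_exists:
  fixes M :: "'a::real_inner set"
  assumes M: "subspace M" "complete M"
  shows "\<exists>y\<in>M. \<forall>m\<in>M. inner (x - y) m = 0"
proof -
  define D where "D = (\<lambda>y. (norm (x - y))\<^sup>2) ` M"
  define I where "I = Inf D"
  have ne: "D \<noteq> {}" using subspace_0[OF M(1)] by (auto simp: D_def)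
  have bdd: "bdd_below D" by (rule bdd_belowI[of _ 0]) (auto simp: D_def)
  have low: "I \<le> (norm (x - y))\<^sup>2" if "y \<in> M" for y
    unfolding I_def using bdd that by (intro cInf_lower) (auto simp: D_def)
  have "\<exists>y\<in>M. (norm (x - y))\<^sup>2 < I + e" if "e > 0" for e
  proof -
    have "\<exists>a\<in>D. a < I + e"
      using cInf_lessD[OF ne, of "I + e"] that by (auto simp: I_def)
    then show ?thesis by (auto simp: D_def)
  qed
  then have "\<exists>y\<in>M. (norm (x - y))\<^sup>2 < I + inverse (real (Suc n))" for n
    by simp
  then obtain y where y: "\<And>n. y n \<in> M"
      "\<And>n. (norm (x - y n))\<^sup>2 < I + inverse (real (Suc n))"
    by metis
  have para: "(norm (y m - y n))\<^sup>2 \<le> 2 * inverse (real (Suc m)) + 2 * inverse (real (Suc n))" for m n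
  proof -
    have "(1/2) *\<^sub>R (y m + y n) \<in> M"
      using M(1) y by (intro subspace_scale subspace_add)
    then have "4 * I \<le> 4 * (norm (x - (1/2) *\<^sub>R (y m + y n)))\<^sup>2"
      using low by simp
    also have "\<dots> = 2 * (norm (x - y m))\<^sup>2 + 2 * (norm (x - y n))\<^sup>2 - (norm (y m - y n))\<^sup>2"
      by (simp add: power2_norm_eq_inner inner_diff_left inner_diff_right inner_add_left
          inner_add_right inner_commute algebra_simps)
    finally show ?thesis using y(2)[of m] y(2)[of n] by linarith
  qed
  have "Cauchy y"
  proof (rule metric_CauchyI)
    fix e :: real assume e: "e > 0"
    then obtain k where k: "inverse (real (Suc k)) < e\<^sup>2 / 4"
      using reals_Archimedean[of "e\<^sup>2 / 4"] by auto
    have "dist (y m) (y n) < e" if "m \<ge> k" "n \<ge> k" for m n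
    proof -
      have "inverse (real (Suc m)) \<le> inverse (real (Suc k))" "inverse (real (Suc n)) \<le> inverse (real (Suc k))"
        using that by (auto intro!: le_imp_inverse_le)
      then have "(norm (y m - y n))\<^sup>2 < e\<^sup>2"
        using para[of m n] k by linarith
      then show ?thesis
        using e by (auto simp: dist_norm intro: power2_less_imp_less)
    qed
    then show "\<exists>k. \<forall>m\<ge>k. \<forall>n\<ge>k. dist (y m) (y n) < e" by blast
  qed
  then obtain p where p: "p \<in> M" "y \<longlonglongrightarrow> p"
    using M(2) y(1) unfolding complete_def by blast
  have "(\<lambda>n. (norm (x - y n))\<^sup>2) \<longlonglongrightarrow> (norm (x - p))\<^sup>2"
    by (intro tendsto_intros p)
  moreover have "(\<lambda>n. I + inverse (real (Suc n))) \<longlonglongrightarrow> I + 0"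
    by (intro tendsto_intros LIMSEQ_inverse_real_of_nat)
  ultimately have min: "(norm (x - p))\<^sup>2 \<le> I"
    using y(2) by (intro LIMSEQ_le[of _ "(norm (x - p))\<^sup>2" _ I]) (auto intro: less_imp_le)
  have "inner (x - p) m = 0" if m: "m \<in> M" for m
  proof (cases "m = 0")
    case False
    \<comment> \<open>The step length that would decrease the distance the most.\<close>
    define t where "t = inner (x - p) m / (norm m)\<^sup>2"
    have "p + t *\<^sub>R m \<in> M"
      using M(1) p(1) m by (intro subspace_add subspace_scale)
    then have "(norm (x - p))\<^sup>2 \<le> (norm (x - (p + t *\<^sub>R m)))\<^sup>2"
      using min by (rule order_trans[OF _ low, rotated])
    also have "x - (p + t *\<^sub>R m) = (x - p) - t *\<^sub>R m" by simp
    also have "(norm \<dots>)\<^sup>2 = (norm (x - p))\<^sup>2 - 2 * t * inner (x - p) m + t\<^sup>2 * (norm m)\<^sup>2"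
      unfolding power2_norm_eq_inner by (simp add: inner_diff_left inner_diff_right inner_commute
         power2_eq_square algebra_simps)
    also have "\<dots> = (norm (x - p))\<^sup>2 - (inner (x - p) m)\<^sup>2 / (norm m)\<^sup>2"
      using False by (simp add: t_def power2_eq_square field_simps)
    finally have "(inner (x - p) m)\<^sup>2 / (norm m)\<^sup>2 \<le> 0" by simp
    then show ?thesis
      using False by (simp add: divide_le_0_iff)
  qed simp
  with p(1) show ?thesis by blast
qed

section \<open>Simultaneous recurrence of rotations\<close>

text \<open>A base of the filter consists of the sets of all large \<open>k\<close> for which finitely many prescribed
  rotations are close to the identity; Dirichlet's theorem says that none of them is empty.  A
  filter, as opposed to a sequence, serves all (uncountably many) rotations at once, so that the
  vanishing of commutators along it is preserved under sums.\<close>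

lemma exists_recurrence_filter:
  "\<exists>F :: nat filter. F \<noteq> bot \<and> F \<le> sequentially \<and>
     (\<forall>\<mu>\<in>sphere (0::complex) 1. ((\<lambda>k. \<mu> ^ k) \<longlongrightarrow> 1) F)"
proof -
  define K where "K = (\<lambda>(\<Lambda> :: complex set, N :: nat). {k. k \<ge> N \<and> (\<forall>\<mu>\<in>\<Lambda>. norm (\<mu> ^ k - 1) < inverse (Suc N))})"
  define J where "J = {(\<Lambda> :: complex set, N :: nat). finite \<Lambda> \<and> \<Lambda> \<subseteq> sphere 0 1}"
  define F where "F = (INF j\<in>J. principal (K j))"
  have ev: "eventually P F \<longleftrightarrow> (\<exists>j\<in>J. \<forall>k\<in>K j. P k)" for P
    unfolding F_def
  proof (subst eventually_INF_base)
    have "({}, 0) \<in> J" by (simp add: J_def)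
    then show "J \<noteq> {}" by blast
    fix a b assume "a \<in> J" "b \<in> J"
    then obtain A M B N where ab: "a = (A, M)" "b = (B, N)" "(A, M) \<in> J" "(B, N) \<in> J"
      by (metis surj_pair)
    have "inverse (real (Suc (max M N))) \<le> inverse (real (Suc M))"
         "inverse (real (Suc (max M N))) \<le> inverse (real (Suc N))"
      by (auto intro!: le_imp_inverse_le)
    then have less: "x < inverse (real (Suc (max M N))) \<Longrightarrow>
        x < inverse (real (Suc M)) \<and> x < inverse (real (Suc N))" for x
      by linarith
    have "K (A \<union> B, max M N) \<subseteq> K (A, M) \<inter> K (B, N)"
      unfolding K_def by (auto dest!: less simp del: of_nat_Suc)
    moreover have "(A \<union> B, max M N) \<in> J"
      using ab by (auto simp: J_def)
    ultimately show "\<exists>x\<in>J. principal (K x) \<le> inf (principal (K a)) (principal (K b))"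
      using ab by (metis inf_principal principal_le_iff)
  qed (auto simp: eventually_principal)
  have "K j \<noteq> {}" if jJ: "j \<in> J" for j
  proof -
    obtain \<Lambda> N where j: "j = (\<Lambda>, N)" "finite \<Lambda>" "\<Lambda> \<subseteq> sphere 0 1"
      using jJ by (auto simp: J_def)
    obtain l :: "nat \<Rightarrow> complex" and n where l: "\<Lambda> = l ` {..<n}"
      using finite_imp_nat_seg_image_inj_on[OF j(2)] by (auto simp: lessThan_def)
    \<comment> \<open>The factor \<open>Suc N\<close> makes the resulting time \<open>Suc N * q\<close> exceed \<open>N\<close>.\<close>
    define \<theta> where "\<theta> i = real (Suc N) * (Arg2pi (l i) / (2 * pi))" for i
    \<comment> \<open>An error of \<open>1 / L\<close> in the angle, measured in turns, moves the point by at most \<open>2 * pi / L\<close>.\<close>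
    define L where "L = nat \<lceil>2 * pi * Suc N\<rceil>"
    have "0 < L" by (simp add: L_def)
    then obtain q p where q: "0 < q" "\<And>i. i < n \<Longrightarrow> \<bar>of_int q * \<theta> i - of_int (p i)\<bar> < 1 / real L"
      by (rule Dirichlet_approx_simult[of L n \<theta>]) blast
    define k where "k = Suc N * nat q"
    have "1 \<le> nat q" using q(1) by simp
    then have "Suc N * 1 \<le> k" unfolding k_def by (rule mult_le_mono2)
    then have "N \<le> k" by simp
    moreover have "norm (\<mu> ^ k - 1) < inverse (Suc N)" if \<mu>: "\<mu> \<in> \<Lambda>" for \<mu>
    proof -
      obtain i where i: "i < n" "\<mu> = l i" using \<mu> l by auto
      have "norm \<mu> = 1" using \<mu> j by auto
      then have "\<mu> = cis (Arg2pi \<mu>)"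
        using Arg2pi[of \<mu>] by (simp add: cis_conv_exp is_Arg_def)
      then have "\<mu> ^ k = cis (real k * Arg2pi \<mu>)"
        by (metis Complex.DeMoivre)
      also have "real k * Arg2pi \<mu> = 2 * pi * (of_int q * \<theta> i)"
        using q(1) by (simp add: k_def \<theta>_def i field_simps)
      also have "\<dots> = 2 * pi * (of_int q * \<theta> i - of_int (p i)) + 2 * pi * of_int (p i)"
        by (simp add: algebra_simps)
      also have "cis \<dots> = cis (2 * pi * (of_int q * \<theta> i - of_int (p i)))"
        by (simp add: cis_multiple_2pi flip: cis_mult)
      finally have "norm (\<mu> ^ k - 1) = norm (cis (2 * pi * (of_int q * \<theta> i - of_int (p i))) - cis 0)"
        by simp
      also have "\<dots> \<le> \<bar>2 * pi * (of_int q * \<theta> i - of_int (p i))\<bar>"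
        using dist_exp_i_1[of "2 * pi * (of_int q * \<theta> i - of_int (p i))"]
          abs_sin_x_le_abs_x[of "2 * pi * (of_int q * \<theta> i - of_int (p i)) / 2"]
        by (simp add: cis_conv_exp)
      also have "\<dots> = 2 * pi * \<bar>of_int q * \<theta> i - of_int (p i)\<bar>" by (simp add: abs_mult)
      also have "\<dots> < 2 * pi * (1 / L)"
        using q(2)[OF i(1)] by (intro mult_strict_left_mono) auto
      also have "\<dots> \<le> inverse (Suc N)"
      proof -
        have "2 * pi * Suc N \<le> L" unfolding L_def by linarith
        then show ?thesis using \<open>0 < L\<close> by (simp add: field_simps)
      qed
      finally show ?thesis .
    qed
    ultimately show ?thesis using j by (auto simp: K_def)
  qed
  then have "F \<noteq> bot"
    unfolding trivial_limit_def ev by auto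
  moreover have "F \<le> sequentially"
    unfolding le_sequentially ev
  proof
    fix N
    have "({}, N) \<in> J" by (simp add: J_def)
    then show "\<exists>j\<in>J. \<forall>n\<in>K j. N \<le> n" by (rule bexI[rotated]) (simp add: K_def)
  qed
  moreover have "((\<lambda>k. \<mu> ^ k) \<longlongrightarrow> 1) F" if "\<mu> \<in> sphere 0 1" for \<mu> :: complex
  proof (rule tendstoI)
    fix e :: real assume "e > 0"
    then obtain N where N: "inverse (Suc N) < e" using reals_Archimedean by blast
    have "({\<mu>}, N) \<in> J" using that by (simp add: J_def)
    then show "eventually (\<lambda>k. dist (\<mu> ^ k) 1 < e) F"
      unfolding ev using N by (intro bexI[of _ "({\<mu>}, N)"]) (auto simp: K_def dist_norm)
  qed
  ultimately show ?thesis by blast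
qed

section \<open>Density of the trigonometric polynomials\<close>

lemma complex_subspace_closure:
  fixes S :: "'a::complex_normed_vector set"
  assumes S: "complex_vector.subspace S"
  shows "complex_vector.subspace (closure S)"
proof (rule complex_vector.subspaceI)
  show "0 \<in> closure S"
    using complex_vector.subspace_0[OF S] closure_subset by blast
  fix x y :: 'a and c assume x: "x \<in> closure S"
  then obtain u where u: "\<forall>k. u k \<in> S" "u \<longlonglongrightarrow> x"
    unfolding closure_sequential by blast
  show "c *\<^sub>C x \<in> closure S"
    unfolding closure_sequential
    using u complex_vector.subspace_scale[OF S] bounded_linear.tendsto[OF bounded_linear_scaleC u(2)]
    by (intro exI[of _ "\<lambda>k. c *\<^sub>C u k"]) auto
  assume "y \<in> closure S"
  then obtain v where v: "\<forall>k. v k \<in> S" "v \<longlonglongrightarrow> y"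
    unfolding closure_sequential by blast
  show "x + y \<in> closure S"
    unfolding closure_sequential
    using u v complex_vector.subspace_add[OF S] tendsto_add[OF u(2) v(2)]
    by (intro exI[of _ "\<lambda>k. u k + v k"]) auto
qed

lemma AE_haarI: "(\<And>z. norm z = 1 \<Longrightarrow> Q z) \<Longrightarrow> AE z in haar. Q z"
  by (rule AE_I2) simp

lemma LinftyI:
  assumes "f \<in> borel_measurable haar" "\<And>z. norm z = 1 \<Longrightarrow> norm (f z) \<le> C"
  shows "f \<in> Linfty"
  using assms AE_haarI[of "\<lambda>z. norm (f z) \<le> C"] by (auto simp: Linfty_def)

lemma borel_measurable_haarI:
  fixes f :: "complex \<Rightarrow> 'a :: topological_space"
  assumes "continuous_on (sphere 0 1) f"
  shows "f \<in> borel_measurable haar"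
  using borel_measurable_continuous_on_restrict[OF assms]
  by (simp cong: measurable_cong_sets add: sets_haar)

lemma mult_op_scaleC: "mult_op f (c *\<^sub>C h) = c *\<^sub>C mult_op f h"
proof (cases "f \<in> Linfty")
  case True
  show ?thesis
    by (rule L2_cases[of h])
       (simp add: scaleC_abs_L2 mult_op_abs_L2 True square_integrable_mult square_integrable_cmult
         mult.left_commute)
next
  case False
  obtain u where "square_integrable u" "h = abs_L2 u" by (rule L2_cases)
  moreover have "square_integrable (\<lambda>z. 0)" by (simp add: square_integrable_def)
  ultimately show ?thesis
    using False
    by (simp add: scaleC_abs_L2 mult_op.rep_eq mult_fun.abs_eq square_integrable_cmult)
qed

lemma zpow_abs_L2: "zpow n = abs_L2 (\<lambda>z. z powi n)"
  by (simp add: zpow_def)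

abbreviation trig :: "L2 set" where
  "trig \<equiv> closure (complex_vector.span (range zpow))"

text \<open>Density is shown through the algebra of bounded functions that preserve the closure of the
  trigonometric polynomials.  It has the advantage over that closure of being closed under products,
  as both the Stone--Weierstrass theorem and the passage from closed sets to Borel sets require.\<close>

definition multiplier :: "(complex \<Rightarrow> complex) \<Rightarrow> bool" where
  "multiplier g \<longleftrightarrow> g \<in> Linfty \<and> (\<forall>h\<in>trig. mult_op g h \<in> trig)"

lemma subspace_trig: "complex_vector.subspace trig"
  by (intro complex_subspace_closure complex_vector.subspace_span)

lemma zpow_in_trig: "zpow n \<in> trig"
  by (meson closure_subset complex_vector.span_base rangeI subsetD)

lemma multiplier_if_zpow:
  assumes g: "g \<in> Linfty" and "\<And>n. mult_op g (zpow n) \<in> trig"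
  shows "multiplier g"
proof -
  have "complex_vector.span (range zpow) \<subseteq> mult_op g -` trig"
  proof (rule complex_vector.span_minimal)
    show "complex_vector.subspace (mult_op g -` trig)"
      using subspace_trig
      by (auto simp: complex_vector.subspace_def mult_op_scaleC blinfun.add_right)
  qed (use assms in auto)
  moreover have "closed (mult_op g -` trig)"
    by (intro closed_vimage continuous_intros) auto
  ultimately have "trig \<subseteq> mult_op g -` trig"
    by (rule closure_minimal)
  with g show ?thesis by (auto simp: multiplier_def)
qed

lemma multiplier_const: "multiplier (\<lambda>z. c)"
proof (rule multiplier_if_zpow)
  show c: "(\<lambda>z. c) \<in> Linfty"
    by (rule LinftyI[of _ "norm c"]) auto
  show "mult_op (\<lambda>z. c) (zpow n) \<in> trig" for n
  proof -
    have "mult_op (\<lambda>z. c) (zpow n) = c *\<^sub>C zpow n"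
      by (simp add: zpow_abs_L2 mult_op_abs_L2 scaleC_abs_L2 c square_integrable_powi)
    then show ?thesis
      by (simp add: complex_vector.subspace_scale[OF subspace_trig zpow_in_trig])
  qed
qed

lemma multiplier_add:
  assumes "multiplier f" "multiplier g"
  shows "multiplier (\<lambda>z. f z + g z)"
proof -
  from assms have f: "f \<in> Linfty" and g: "g \<in> Linfty" by (auto simp: multiplier_def)
  have [measurable]: "f \<in> borel_measurable haar" "g \<in> borel_measurable haar"
    using f g by (auto simp: Linfty_def)
  obtain C where C: "AE z in haar. norm (f z) \<le> C" using f by (rule LinftyE)
  obtain C' where C': "AE z in haar. norm (g z) \<le> C'" using g by (rule LinftyE)
  have "AE z in haar. norm (f z + g z) \<le> C + C'"
    using C C' by eventually_elim (rule norm_triangle_mono)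
  then have fg: "(\<lambda>z. f z + g z) \<in> Linfty"
    by (auto simp: Linfty_def)
  have "mult_op (\<lambda>z. f z + g z) h = mult_op f h + mult_op g h" for h
    by (rule L2_cases[of h])
       (simp add: f g fg mult_op_abs_L2 abs_L2_ops square_integrable_mult distrib_right)
  then show ?thesis
    using assms fg complex_vector.subspace_add[OF subspace_trig] by (auto simp: multiplier_def)
qed

lemma multiplier_mult:
  assumes "multiplier f" "multiplier g"
  shows "multiplier (\<lambda>z. f z * g z)"
proof -
  from assms have f: "f \<in> Linfty" and g: "g \<in> Linfty" by (auto simp: multiplier_def)
  have [measurable]: "f \<in> borel_measurable haar" "g \<in> borel_measurable haar"
    using f g by (auto simp: Linfty_def)
  obtain C where C: "C \<ge> 0" "AE z in haar. norm (f z) \<le> C" using f by (rule LinftyE)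
  obtain C' where C': "AE z in haar. norm (g z) \<le> C'" using g by (rule LinftyE)
  have "AE z in haar. norm (f z * g z) \<le> C * C'"
    using C(2) C' by eventually_elim (use C(1) in \<open>simp add: norm_mult mult_mono\<close>)
  then have fg: "(\<lambda>z. f z * g z) \<in> Linfty"
    by (auto simp: Linfty_def)
  have "mult_op (\<lambda>z. f z * g z) h = mult_op f (mult_op g h)" for h
    by (rule L2_cases[of h])
       (simp add: f g fg mult_op_abs_L2 square_integrable_mult mult.assoc)
  then show ?thesis
    using assms fg by (auto simp: multiplier_def)
qed

text \<open>On the circle, multiplication by \<open>z\<close> and by its conjugate \<open>z\<^sup>-\<^sup>1\<close> only shifts the basis.\<close>

lemma multiplier_z: "multiplier (\<lambda>z. z)" and multiplier_cnj: "multiplier cnj"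
proof -
  have z: "(\<lambda>z. z) \<in> Linfty"
    by (rule LinftyI[of _ 1]) (auto intro!: borel_measurable_haarI)
  have c: "cnj \<in> Linfty"
    by (rule LinftyI[of _ 1]) (auto intro!: borel_measurable_haarI continuous_intros)
  have "mult_op (\<lambda>z. z) (zpow n) = zpow (1 + n)" for n
  proof -
    have "z * z powi n = z powi (1 + n)" if "norm z = 1" for z :: complex
      using that by (subst power_int_add) auto
    then show ?thesis
      using square_integrable_mult[OF z square_integrable_powi]
      by (auto simp: zpow_abs_L2 mult_op_abs_L2 z square_integrable_powi L2_eq_iff
          intro!: AE_haarI)
  qed
  then show "multiplier (\<lambda>z. z)"
    by (intro multiplier_if_zpow z) (simp add: zpow_in_trig)
  have "mult_op cnj (zpow n) = zpow (n - 1)" for n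
  proof -
    have "cnj z * z powi n = z powi (n - 1)" if "norm z = 1" for z
    proof -
      have "cnj z * z = 1" "z \<noteq> 0"
        using that complex_norm_square[of z] by (auto simp: mult.commute)
      then show ?thesis
        by (simp add: power_int_diff nonzero_eq_divide_eq algebra_simps)
    qed
    then show ?thesis
      using square_integrable_mult[OF c square_integrable_powi]
      by (auto simp: zpow_abs_L2 mult_op_abs_L2 c square_integrable_powi L2_eq_iff
          intro!: AE_haarI)
  qed
  then show "multiplier cnj"
    by (intro multiplier_if_zpow c) (simp add: zpow_in_trig)
qed

lemma multiplier_LIMSEQ:
  assumes s: "\<And>n. multiplier (s n)"
    and bound: "\<And>n z. norm z = 1 \<Longrightarrow> norm (s n z) \<le> C"
    and lim: "\<And>z. norm z = 1 \<Longrightarrow> (\<lambda>n. s n z) \<longlonglongrightarrow> g z"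
  shows "multiplier g"
proof -
  have sL: "s n \<in> Linfty" for n using s by (simp add: multiplier_def)
  then have [measurable]: "s n \<in> borel_measurable haar" for n by (auto simp: Linfty_def)
  have "g \<in> borel_measurable haar"
    by (rule borel_measurable_LIMSEQ_metric[of s]) (auto simp: lim)
  moreover have "norm (g z) \<le> C" if "norm z = 1" for z
    using tendsto_norm[OF lim[OF that]] bound[OF that] by (intro LIMSEQ_le_const2) auto
  ultimately have g: "g \<in> Linfty" by (rule LinftyI)
  have "mult_op g h \<in> trig" if "h \<in> trig" for h
  proof -
    obtain u where u: "square_integrable u" "h = abs_L2 u" by (rule L2_cases)
    have "(\<lambda>n. abs_L2 (\<lambda>z. s n z * u z)) \<longlonglongrightarrow> abs_L2 (\<lambda>z. g z * u z)"
    proof (rule L2_dominated_convergence)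
      show "AE z in haar. (\<lambda>n. s n z * u z) \<longlonglongrightarrow> g z * u z"
        by (intro AE_haarI tendsto_intros lim)
      show "AE z in haar. norm (s n z * u z) \<le> norm (complex_of_real \<bar>C\<bar> * u z)" for n
      proof (rule AE_haarI)
        fix z :: complex assume "norm z = 1"
        then have "norm (s n z) \<le> \<bar>C\<bar>" using bound[of z n] by linarith
        then show "norm (s n z * u z) \<le> norm (complex_of_real \<bar>C\<bar> * u z)"
          by (simp add: norm_mult mult_right_mono)
      qed
    qed (intro square_integrable_mult square_integrable_cmult g sL u(1))+
    then have "(\<lambda>n. mult_op (s n) h) \<longlonglongrightarrow> mult_op g h"
      by (simp add: u mult_op_abs_L2 g sL)
    moreover have "mult_op (s n) h \<in> trig" for n
      using s that by (simp add: multiplier_def)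
    ultimately show ?thesis
      by (rule closed_sequentially[OF closed_closure, rotated])
  qed
  with g show ?thesis by (simp add: multiplier_def)
qed

text \<open>Real and imaginary parts are multipliers and separate points, so that Stone--Weierstrass applies to
  the real-valued multipliers.\<close>

lemma multiplier_continuous:
  fixes u :: "complex \<Rightarrow> real"
  assumes u: "continuous_on (sphere 0 1) u"
  shows "multiplier (\<lambda>z. complex_of_real (u z))"
proof -
  let ?P = "\<lambda>f. continuous_on (sphere 0 1) f \<and> multiplier (\<lambda>z. complex_of_real (f z))"
  have Re: "?P Re"
    using multiplier_mult[OF multiplier_const[of "1/2"]
        multiplier_add[OF multiplier_z multiplier_cnj]]
    by (auto intro!: continuous_intros simp: complex_add_cnj)
  have "complex_of_real (Im z) = - \<i> / 2 * (z + (-1) * cnj z)" for z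
    by (simp add: complex_eq_iff)
  then have "(\<lambda>z. complex_of_real (Im z)) = (\<lambda>z. - \<i> / 2 * (z + (-1) * cnj z))"
    by (rule ext)
  then have "multiplier (\<lambda>z. complex_of_real (Im z))"
    using multiplier_mult[OF multiplier_const[of "- \<i> / 2"]
        multiplier_add[OF multiplier_z multiplier_mult[OF multiplier_const[of "-1"] multiplier_cnj]]]
    by (simp only:)
  then have Im: "?P Im"
    by (intro conjI continuous_intros)
  have "\<exists>f. ?P f \<and> (\<forall>z\<in>sphere 0 1. \<bar>u z - f z\<bar> < inverse (Suc n))" for n
  proof (rule Stone_Weierstrass_HOL)
    fix x y :: complex assume "x \<in> sphere 0 1 \<and> y \<in> sphere 0 1 \<and> x \<noteq> y"
    then show "\<exists>f. ?P f \<and> f x \<noteq> f y"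
      using Re Im complex_eqI by metis
  qed (use u in \<open>auto intro!: continuous_intros multiplier_add multiplier_mult multiplier_const\<close>)
  then have "\<exists>f. \<forall>n. ?P (f n) \<and> (\<forall>z\<in>sphere 0 1. \<bar>u z - f n z\<bar> < inverse (Suc n))"
    by (intro choice allI)
  then obtain f where f': "\<forall>n. ?P (f n) \<and> (\<forall>z\<in>sphere 0 1. \<bar>u z - f n z\<bar> < inverse (Suc n))"
    by blast
  then have f: "\<bar>u z - f n z\<bar> < inverse (Suc n)" if "norm z = 1" for n z
    using that by simp
  obtain B where "\<forall>y\<in>u ` sphere 0 1. norm y \<le> B"
    using compact_imp_bounded[OF compact_continuous_image[OF u compact_sphere]]
    unfolding bounded_iff by blast
  then have B: "\<bar>u z\<bar> \<le> B" if "norm z = 1" for z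
    using that by simp
  show ?thesis
  proof (rule multiplier_LIMSEQ[of "\<lambda>n z. complex_of_real (f n z)"])
    fix z :: complex and n assume z: "norm z = 1"
    have "inverse (real (Suc n)) \<le> 1" by (simp add: inverse_le_1_iff)
    then have "\<bar>f n z\<bar> \<le> B + 1" using f[OF z, of n] B[OF z] by linarith
    then show "norm (complex_of_real (f n z)) \<le> B + 1" by simp
  next
    fix z :: complex assume z: "norm z = 1"
    have "(\<lambda>n. f n z - u z) \<longlonglongrightarrow> 0"
      using f[OF z] by (intro Lim_null_comparison[OF _ LIMSEQ_inverse_real_of_nat] always_eventually)
        (auto simp: abs_minus_commute intro: less_imp_le)
    then show "(\<lambda>n. complex_of_real (f n z)) \<longlonglongrightarrow> complex_of_real (u z)"
      by (intro tendsto_of_real) (simp add: Lim_null[of _ "u z"])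
  qed (use f' in blast)
qed

lemma multiplier_indicator_empty: "multiplier (indicator {})"
  using multiplier_const[of 0] by (simp add: indicator_def[abs_def])

text \<open>The indicator of \<open>A\<close> is the bounded pointwise limit of the powers of a continuous function which is
  \<open>1\<close> on \<open>A\<close> and less than \<open>1\<close> elsewhere.\<close>

lemma multiplier_indicator_closed:
  assumes "closed A"
  shows "multiplier (indicator A)"
proof (cases "A = {}")
  case False
  define g where "g z = complex_of_real (1 / (1 + infdist z A))" for z
  have pos: "1 + infdist z A > 0" for z using infdist_nonneg[of z A] by linarith
  then have "multiplier g"
    unfolding g_def
    by (intro multiplier_continuous continuous_intros) (metis less_irrefl)
  then have "multiplier (\<lambda>z. g z ^ n)" for n
    by (induction n) (auto intro: multiplier_const multiplier_mult)
  then show ?thesis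
  proof (rule multiplier_LIMSEQ)
    fix z
    have n: "norm (g z) = 1 / (1 + infdist z A)"
      unfolding g_def norm_of_real using pos[of z] by simp
    have le: "norm (g z) \<le> 1" unfolding n using infdist_nonneg[of z A] by simp
    then show "norm (g z ^ n) \<le> 1" for n by (simp add: norm_power power_le_one)
    show "(\<lambda>n. g z ^ n) \<longlonglongrightarrow> indicator A z"
    proof (cases "z \<in> A")
      case False
      then have "infdist z A > 0"
        using in_closed_iff_infdist_zero[OF assms \<open>A \<noteq> {}\<close>, of z] infdist_nonneg[of z A] by simp
      then have "norm (g z) < 1" unfolding n by simp
      then show ?thesis using False by (simp add: LIMSEQ_power_zero)
    qed (simp add: g_def)
  qed
qed (simp add: multiplier_indicator_empty)

lemma multiplier_indicator_borel:
  assumes "A \<in> sets (borel :: complex measure)"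
  shows "multiplier (indicator A)"
proof -
  have "A \<in> sigma_sets UNIV {S :: complex set. closed S}"
    using assms by (simp add: borel_eq_closed)
  then show ?thesis
  proof (induction A rule: sigma_sets.induct)
    case (Compl A)
    have "indicator (UNIV - A) = (\<lambda>z. 1 + (-1) * indicator A z :: complex)"
      by (auto simp: indicator_def fun_eq_iff)
    then show ?case
      using multiplier_add[OF multiplier_const[of 1]
        multiplier_mult[OF multiplier_const[of "-1"] Compl.IH]] by simp
  next
    case (Union A)
    have "multiplier (indicator (\<Union>i<n. A i))" for n :: nat
    proof (induction n)
      case 0
      show ?case by (simp only: lessThan_0 UN_empty multiplier_indicator_empty)
    next
      case (Suc n)
      have "indicator (\<Union>i<Suc n. A i) = (\<lambda>z. indicator (\<Union>i<n. A i) z +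
          (indicator (A n) z + (-1) * (indicator (\<Union>i<n. A i) z * indicator (A n) z)) :: complex)"
        by (auto simp: indicator_def fun_eq_iff less_Suc_eq)
      then show ?case
        using multiplier_add[OF Suc multiplier_add[OF Union.IH[of n]
            multiplier_mult[OF multiplier_const[of "-1"] multiplier_mult[OF Suc Union.IH[of n]]]]]
        by simp
    qed
    then show ?case
    proof (rule multiplier_LIMSEQ)
      show "norm (indicator (\<Union>i<n. A i) z :: complex) \<le> 1" for n z
        by (simp add: indicator_def)
      show "(\<lambda>n. indicator (\<Union>i<n. A i) z) \<longlonglongrightarrow> (indicator (\<Union>i. A i) z :: complex)" for z
        by (rule LIMSEQ_indicator_UN)
    qed
  qed (simp_all add: multiplier_const multiplier_indicator_closed)
qed

lemma multiplier_sum: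
  assumes "finite I" "\<And>i. i \<in> I \<Longrightarrow> multiplier (f i)"
  shows "multiplier (\<lambda>z. \<Sum>i\<in>I. f i z)"
  using assms by (induction I) (auto intro: multiplier_add multiplier_const)

lemma multiplier_simple_function:
  assumes "simple_function haar s"
  shows "multiplier s"
proof -
  let ?Y = "s ` sphere 0 1"
  have fin: "finite ?Y" and meas: "\<And>y. y \<in> ?Y \<Longrightarrow> s -` {y} \<inter> sphere 0 1 \<in> sets haar"
    using assms by (auto simp: simple_function_def)
  let ?t = "\<lambda>z. \<Sum>y\<in>?Y. y * indicator (s -` {y} \<inter> sphere 0 1) z"
  have "A \<in> sets borel" if "A \<in> sets haar" for A
    using that by (auto simp: sets_haar sets_restrict_space)
  then have "multiplier ?t"
    using meas fin
    by (intro multiplier_sum multiplier_mult[OF multiplier_const] multiplier_indicator_borel) blast+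
  moreover have "?t z = s z" if "norm z = 1" for z
  proof -
    have "?t z = (\<Sum>y\<in>?Y. if y = s z then s z else 0)"
      using that by (intro sum.cong) (auto simp: indicator_def)
    also have "\<dots> = s z" using that fin by (subst sum.delta) auto
    finally show ?thesis .
  qed
  moreover obtain C where "\<forall>y\<in>?Y. norm y \<le> C"
    using finite_imp_bounded[OF fin] unfolding bounded_iff by blast
  then have "norm (s z) \<le> C" if "norm z = 1" for z
    using that by simp
  ultimately show ?thesis
    by (intro multiplier_LIMSEQ[of "\<lambda>n. ?t" C s]) simp_all
qed

text \<open>Every square integrable function is a dominated limit of simple functions, and a simple function
  is a multiplier applied to the constant function \<open>1\<close>.\<close>

lemma trig_dense: "trig = UNIV"
proof -
  have "h \<in> trig" for h
  proof -
    obtain f where f: "square_integrable f" "h = abs_L2 f" by (rule L2_cases)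
    obtain s where "\<forall>i. simple_function haar (s i)"
        "\<forall>z\<in>space haar. (\<lambda>i. s i z) \<longlonglongrightarrow> f z"
        "\<forall>i. \<forall>z\<in>space haar. dist (s i z) 0 \<le> 2 * dist (f z) 0"
      using borel_measurable_implies_sequence_metric[OF square_integrable_measurable[OF f(1)], of 0]
      by blast
    then have s: "\<And>i. simple_function haar (s i)"
        "\<And>z. norm z = 1 \<Longrightarrow> (\<lambda>i. s i z) \<longlonglongrightarrow> f z"
        "\<And>i z. norm z = 1 \<Longrightarrow> norm (s i z) \<le> 2 * norm (f z)"
      by auto
    have 1: "square_integrable (\<lambda>z. 1)" using square_integrable_powi[of 0] by simp
    have m: "multiplier (s i)" for i by (intro multiplier_simple_function s)
    then have sL: "s i \<in> Linfty" for i by (simp add: multiplier_def)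
    have si: "square_integrable (s i)" for i
      using square_integrable_mult[OF sL[of i] 1] by simp
    have "abs_L2 (s i) = mult_op (s i) (zpow 0)" for i
      by (simp add: zpow_abs_L2 mult_op_abs_L2 sL 1)
    then have "abs_L2 (s i) \<in> trig" for i
      using m zpow_in_trig by (simp add: multiplier_def)
    moreover have "(\<lambda>i. abs_L2 (s i)) \<longlonglongrightarrow> abs_L2 f"
    proof (rule L2_dominated_convergence[where w = "\<lambda>z. 2 * f z"])
      show "AE z in haar. norm (s n z) \<le> norm (2 * f z)" for n
        by (rule AE_haarI) (simp add: norm_mult s)
      show "AE z in haar. (\<lambda>i. s i z) \<longlonglongrightarrow> f z"
        by (rule AE_haarI) (simp add: s)
    qed (intro square_integrable_cmult f si)+
    ultimately show ?thesis
      unfolding f(2) by (rule closed_sequentially[OF closed_closure])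
  qed
  then show ?thesis by blast
qed

section \<open>The projection onto the Hardy space\<close>

lemma Re_cinner: "Re (cinner f g) = inner f g"
  by transfer simp

lemma cinner_scaleC_right: "cinner f (c *\<^sub>C g) = cnj c * cinner f g"
proof transfer
  fix f g :: "complex \<Rightarrow> complex" and c
  have "(\<lambda>z. f z * cnj (c * g z)) = (\<lambda>z. cnj c * (f z * cnj (g z)))"
    by (simp add: fun_eq_iff)
  then show "(LINT z|haar. f z * cnj (c * g z)) = cnj c * (LINT z|haar. f z * cnj (g z))"
    by simp
qed

lemma cinner_scaleC_left: "cinner (c *\<^sub>C f) g = c * cinner f g"
  by transfer (simp add: mult.assoc)

text \<open>Orthogonality to a complex subspace can be tested on the real inner product, since the imaginary
  part of \<open>cinner f g\<close> is the real part of \<open>cinner f (\<i> g)\<close>.\<close>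

lemma cinner_eq_0_if_inner:
  assumes "complex_vector.subspace M" "\<And>m. m \<in> M \<Longrightarrow> inner f m = 0" "g \<in> M"
  shows "cinner f g = 0"
proof (rule complex_eqI)
  have "Im (cinner f g) = Re (cinner f (\<i> *\<^sub>C g))"
    by (simp add: cinner_scaleC_right)
  also have "\<dots> = 0"
    using assms by (simp add: Re_cinner complex_vector.subspace_scale)
  finally show "Im (cinner f g) = Im 0" by simp
qed (use assms in \<open>simp add: Re_cinner\<close>)

lemma complex_subspace_hardy: "complex_vector.subspace hardy"
  unfolding hardy_def by (intro complex_subspace_closure complex_vector.subspace_span)

lemma hardy_proj_unique:
  assumes "p \<in> hardy" "\<And>g. g \<in> hardy \<Longrightarrow> inner (h - p) g = 0"
    and "q \<in> hardy" "\<And>g. g \<in> hardy \<Longrightarrow> inner (h - q) g = 0"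
  shows "p = q"
proof -
  have "inner (p - q) (p - q) = inner (h - q) (p - q) - inner (h - p) (p - q)"
    by (simp add: inner_diff_left)
  also have "\<dots> = 0" using assms by (simp add: hardy_diff)
  finally show ?thesis by simp
qed

text \<open>Choosing the nearest point of the Hardy space for each \<open>h\<close> yields, by uniqueness, a linear
  contraction, which is the operator described by \<open>hardy_proj\<close>.\<close>

lemma hardy_proj_spec:
  "(\<forall>h. hardy_proj h \<in> hardy \<and> (\<forall>g\<in>hardy. cinner (h - hardy_proj h) g = 0))"
  unfolding hardy_proj_def
proof (rule theI')
  have "complete hardy"
    using complete_closed_subset[OF _ _ L2_complete, of hardy] by (simp add: hardy_def)
  moreover have "subspace hardy"
    by (simp add: subspace_def hardy_zero hardy_add hardy_scaleR)
  ultimately have "\<forall>h. \<exists>p\<in>hardy. \<forall>g\<in>hardy. inner (h - p) g = 0"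
    using orthogonal_projection_exists by blast
  then obtain p where p: "\<And>h. p h \<in> hardy" "\<And>h g. g \<in> hardy \<Longrightarrow> inner (h - p h) g = 0"
    by metis
  have "bounded_linear p"
  proof (rule bounded_linear_intro[where K = 1])
    fix x y :: L2 and r :: real
    show "p (x + y) = p x + p y"
    proof (rule hardy_proj_unique[where h = "x + y"])
      fix g assume g: "g \<in> hardy"
      have "x + y - (p x + p y) = (x - p x) + (y - p y)" by simp
      then show "inner (x + y - (p x + p y)) g = 0"
        by (simp only: inner_add_left p(2)[OF g])
    qed (auto intro: p hardy_add)
    show "p (r *\<^sub>R x) = r *\<^sub>R p x"
    proof (rule hardy_proj_unique[where h = "r *\<^sub>R x"])
      fix g assume g: "g \<in> hardy"
      have "r *\<^sub>R x - r *\<^sub>R p x = r *\<^sub>R (x - p x)" by (simp add: scaleR_diff_right)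
      then show "inner (r *\<^sub>R x - r *\<^sub>R p x) g = 0"
        by (simp only: inner_scaleR_left p(2)[OF g])
    qed (auto intro: p hardy_scaleR)
    have "norm (p x) * norm (p x) = inner x (p x)"
      using p(2)[OF p(1)[of x], of x] by (simp add: inner_diff_left dot_square_norm power2_eq_square)
    also have "\<dots> \<le> norm x * norm (p x)" by (rule norm_cauchy_schwarz)
    finally show "norm (p x) \<le> norm x * 1"
      by (cases "p x = 0") auto
  qed
  then have "blinfun_apply (Blinfun p) = p" by (rule bounded_linear_Blinfun_apply)
  moreover have "cinner (h - p h) g = 0" if "g \<in> hardy" for h g
    using complex_subspace_hardy p(2) that by (rule cinner_eq_0_if_inner)
  ultimately have ex: "\<forall>h. Blinfun p h \<in> hardy \<and> (\<forall>g\<in>hardy. cinner (h - Blinfun p h) g = 0)"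
    using p(1) by simp
  show "\<exists>!Q :: L2 \<Rightarrow>\<^sub>L L2. \<forall>h. Q h \<in> hardy \<and> (\<forall>g\<in>hardy. cinner (h - Q h) g = 0)"
  proof (rule ex1I, rule ex)
    fix Q :: "L2 \<Rightarrow>\<^sub>L L2"
    assume Q: "\<forall>h. Q h \<in> hardy \<and> (\<forall>g\<in>hardy. cinner (h - Q h) g = 0)"
    show "Q = Blinfun p"
    proof (rule blinfun_eqI)
      fix h
      show "Q h = Blinfun p h"
        by (rule hardy_proj_unique[where h = h]) (use Q ex in \<open>auto simp flip: Re_cinner\<close>)
    qed
  qed
qed

lemma hardy_proj_in_hardy: "hardy_proj h \<in> hardy"
  using hardy_proj_spec by blast

lemma inner_hardy_proj: "g \<in> hardy \<Longrightarrow> inner (h - hardy_proj h) g = 0"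
  using hardy_proj_spec by (simp flip: Re_cinner)

lemma hardy_proj_eqI:
  assumes "p \<in> hardy" "\<And>g. g \<in> hardy \<Longrightarrow> inner (h - p) g = 0"
  shows "hardy_proj h = p"
  by (rule hardy_proj_unique[OF hardy_proj_in_hardy inner_hardy_proj assms])

lemma hardy_proj_id: "h \<in> hardy \<Longrightarrow> hardy_proj h = h"
  by (rule hardy_proj_eqI) auto

lemma hardy_proj_scaleC: "hardy_proj (c *\<^sub>C h) = c *\<^sub>C hardy_proj h"
proof (rule hardy_proj_eqI)
  fix g assume g: "g \<in> hardy"
  have "inner (c *\<^sub>C h - c *\<^sub>C hardy_proj h) g = Re (cinner (c *\<^sub>C (h - hardy_proj h)) g)"
    by (simp add: Re_cinner complex_vector.scale_right_diff_distrib)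
  also have "\<dots> = 0" using hardy_proj_spec g by (simp add: cinner_scaleC_left)
  finally show "inner (c *\<^sub>C h - c *\<^sub>C hardy_proj h) g = 0" by simp
qed (simp add: hardy_scaleC hardy_proj_in_hardy)

lemma norm_hardy_proj_le: "norm (hardy_proj h) \<le> norm h"
proof -
  have "norm (hardy_proj h) * norm (hardy_proj h) = inner h (hardy_proj h)"
    using inner_hardy_proj[OF hardy_proj_in_hardy[of h], of h]
    by (simp add: inner_diff_left dot_square_norm power2_eq_square)
  also have "\<dots> \<le> norm h * norm (hardy_proj h)" by (rule norm_cauchy_schwarz)
  finally show ?thesis by (cases "hardy_proj h = 0") auto
qed

section \<open>Asymptotics along the shift\<close>

abbreviation shift :: "nat \<Rightarrow> L2 \<Rightarrow>\<^sub>L L2" where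
  "shift k \<equiv> mult_op (\<lambda>z. z ^ k)"

lemma power_Linfty: "(\<lambda>z. z ^ k) \<in> Linfty"
  by (rule LinftyI[of _ 1]) (auto intro!: borel_measurable_haarI continuous_intros simp: norm_power)

lemma norm_shift: "norm (shift k h) = norm h"
proof -
  obtain f where f: "square_integrable f" "h = abs_L2 f" by (rule L2_cases)
  have "(LINT z|haar. (norm (z ^ k * f z))\<^sup>2) = (LINT z|haar. (norm (f z))\<^sup>2)"
    by (rule Bochner_Integration.integral_cong) (auto simp: norm_mult norm_power)
  then show ?thesis
    by (simp add: f mult_op_abs_L2 power_Linfty norm_abs_L2 square_integrable_mult)
qed

lemma shift_zpow: "shift k (zpow n) = zpow (n + int k)"
proof -
  have "z ^ k * z powi n = z powi (n + int k)" if "norm z = 1" for z :: complex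
    using that by (subst power_int_add) (auto simp: mult.commute)
  then show ?thesis
    using square_integrable_mult[OF power_Linfty square_integrable_powi]
    by (auto simp: zpow_abs_L2 mult_op_abs_L2 power_Linfty square_integrable_powi L2_eq_iff
        intro!: AE_haarI)
qed

lemma mult_rot_shift:
  assumes f: "f \<in> Linfty" and \<mu>: "norm \<mu> = 1"
  shows "mult_op f (rot_op \<mu> (shift k h)) = \<mu> ^ k *\<^sub>C shift k (mult_op f (rot_op \<mu> h))"
proof -
  obtain u where u: "square_integrable u" "h = abs_L2 u" by (rule L2_cases)
  have "mult_op f (rot_op \<mu> (shift k h)) = abs_L2 (\<lambda>z. f z * ((\<mu> * z) ^ k * u (\<mu> * z)))"
    using square_integrable_rotation[OF \<mu> square_integrable_mult[OF power_Linfty u(1)]]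
    by (simp add: u mult_op_abs_L2 rot_op_abs_L2 power_Linfty f \<mu> square_integrable_mult)
  also have "\<dots> = abs_L2 (\<lambda>z. \<mu> ^ k * (z ^ k * (f z * u (\<mu> * z))))"
    by (simp add: power_mult_distrib mult_ac)
  also have "\<dots> = \<mu> ^ k *\<^sub>C shift k (mult_op f (rot_op \<mu> h))"
    by (simp add: u mult_op_abs_L2 rot_op_abs_L2 scaleC_abs_L2 power_Linfty f \<mu>
        square_integrable_mult square_integrable_rotation)
  finally show ?thesis .
qed

text \<open>The shift moves the frequency \<open>n\<close> to \<open>n + k\<close>, which lies in the Hardy space once \<open>k \<ge> -n\<close>.  Density
  extends the limit to all of \<open>L\<^sup>2\<close>, as the operators involved are bounded uniformly in \<open>k\<close>.\<close>

lemma hardy_proj_shift_tendsto: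
  "(\<lambda>k. hardy_proj (shift k g) - shift k g) \<longlonglongrightarrow> 0"
proof -
  define G where "G = {g. (\<lambda>k. hardy_proj (shift k g) - shift k g) \<longlonglongrightarrow> 0}"
  have "complex_vector.span (range zpow) \<subseteq> G"
  proof (rule complex_vector.span_minimal)
    show "range zpow \<subseteq> G"
    proof clarify
      fix n
      have "hardy_proj (shift k (zpow n)) - shift k (zpow n) = 0" if "k \<ge> nat (- n)" for k
      proof -
        have "zpow (n + int k) \<in> hardy"
          unfolding hardy_def using that
          by (intro subsetD[OF closure_subset] complex_vector.span_base) auto
        then show ?thesis by (simp add: shift_zpow hardy_proj_id)
      qed
      then show "zpow n \<in> G"
        unfolding G_def mem_Collect_eq
        by (intro tendsto_eventually eventually_sequentiallyI)
    qed
    show "complex_vector.subspace G"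
    proof (rule complex_vector.subspaceI)
      show "0 \<in> G" by (simp add: G_def blinfun.zero_right)
      fix x y c assume x: "x \<in> G"
      then show "c *\<^sub>C x \<in> G"
        using bounded_linear.tendsto[OF bounded_linear_scaleC,
            of "\<lambda>k. hardy_proj (shift k x) - shift k x" 0 sequentially c]
        by (simp add: G_def mult_op_scaleC hardy_proj_scaleC complex_vector.scale_right_diff_distrib)
      assume "y \<in> G"
      then show "x + y \<in> G"
        using x tendsto_add[of "\<lambda>k. hardy_proj (shift k x) - shift k x" 0 sequentially
            "\<lambda>k. hardy_proj (shift k y) - shift k y" 0]
        by (simp add: G_def blinfun.add_right algebra_simps)
    qed
  qed
  moreover have "g \<in> closure (complex_vector.span (range zpow))"
    by (simp add: trig_dense)
  ultimately have g: "g \<in> closure G"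
    using closure_mono by blast
  show ?thesis
  proof (rule tendstoI)
    fix e :: real assume "e > 0"
    then obtain g' where g': "g' \<in> G" "norm (g - g') < e / 3"
      using g unfolding closure_approachable by (metis dist_norm dist_commute divide_pos_pos zero_less_numeral)
    have "\<forall>\<^sub>F k in sequentially. norm (hardy_proj (shift k g') - shift k g') < e / 3"
      using g'(1) \<open>e > 0\<close> tendstoD[of _ 0 sequentially "e / 3"] by (fastforce simp: G_def)
    then show "\<forall>\<^sub>F k in sequentially. dist (hardy_proj (shift k g) - shift k g) 0 < e"
    proof (rule eventually_mono)
      fix k assume k: "norm (hardy_proj (shift k g') - shift k g') < e / 3"
      have "hardy_proj (shift k g) - shift k g = (hardy_proj (shift k g') - shift k g')
          + (hardy_proj (shift k (g - g')) - shift k (g - g'))"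
        by (simp add: blinfun.diff_right)
      also have "norm \<dots> \<le> norm (hardy_proj (shift k g') - shift k g')
          + (norm (hardy_proj (shift k (g - g'))) + norm (shift k (g - g')))"
        by (intro norm_triangle_mono norm_triangle_ineq4 order_refl)
      also have "\<dots> \<le> norm (hardy_proj (shift k g') - shift k g') + 2 * norm (g - g')"
        using norm_hardy_proj_le[of "shift k (g - g')"] by (simp add: norm_shift)
      also have "\<dots> < e" using k g'(2) by linarith
      finally show "dist (hardy_proj (shift k g) - shift k g) 0 < e" by simp
    qed
  qed
qed

abbreviation (input) mult_rot_ops :: "(L2 \<Rightarrow>\<^sub>L L2) set" where
  "mult_rot_ops \<equiv> {mult_op f o\<^sub>L rot_op \<mu> |f \<mu>. f \<in> Linfty \<and> \<mu> \<in> sphere 0 1}"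

text \<open>For a single \<open>M\<^sub>f V\<^sub>\<mu>\<close> the commutator with the shift is \<open>(\<mu>\<^sup>k - 1) S\<^sub>k M\<^sub>f V\<^sub>\<mu>\<close>, and the operators with
  vanishing commutators form a subspace.\<close>

lemma commutator_tendsto:
  assumes F: "\<And>\<mu>. \<mu> \<in> sphere (0::complex) 1 \<Longrightarrow> ((\<lambda>k. \<mu> ^ k) \<longlongrightarrow> 1) F"
    and X: "X \<in> complex_vector.span mult_rot_ops"
  shows "((\<lambda>k. X (shift k h) - shift k (X h)) \<longlongrightarrow> 0) F"
proof -
  define G where "G = {X :: L2 \<Rightarrow>\<^sub>L L2. ((\<lambda>k. X (shift k h) - shift k (X h)) \<longlongrightarrow> 0) F}"
  have "complex_vector.span mult_rot_ops \<subseteq> G"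
  proof (rule complex_vector.span_minimal)
    show "mult_rot_ops \<subseteq> G"
    proof clarify
      fix f \<mu> assume f: "f \<in> Linfty" and \<mu>: "\<mu> \<in> sphere (0::complex) 1"
      let ?X = "mult_op f o\<^sub>L rot_op \<mu>"
      have "norm (?X (shift k h) - shift k (?X h)) = norm (\<mu> ^ k - 1) * norm (?X h)" for k
      proof -
        have "?X (shift k h) - shift k (?X h) = (\<mu> ^ k - 1) *\<^sub>C shift k (?X h)"
          using \<mu> by (simp add: mult_rot_shift[OF f] complex_vector.scale_left_diff_distrib scaleC_one)
        then show ?thesis by (simp add: norm_scaleC norm_shift)
      qed
      moreover have "((\<lambda>k. norm (\<mu> ^ k - 1) * norm (?X h)) \<longlongrightarrow> norm (1 - 1 :: complex) * norm (?X h)) F"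
        by (intro tendsto_intros F \<mu>)
      ultimately show "?X \<in> G"
        unfolding G_def mem_Collect_eq by (subst tendsto_norm_zero_iff[symmetric]) simp
    qed
    show "complex_vector.subspace G"
    proof (rule complex_vector.subspaceI)
      show "0 \<in> G" by (simp add: G_def blinfun.zero_right)
      fix X Y c assume X: "X \<in> G"
      then show "c *\<^sub>C X \<in> G"
        using bounded_linear.tendsto[OF bounded_linear_scaleC,
            of "\<lambda>k. X (shift k h) - shift k (X h)" 0 F c]
        by (simp add: G_def scaleC_blinfun.rep_eq mult_op_scaleC complex_vector.scale_right_diff_distrib)
      assume "Y \<in> G"
      then show "X + Y \<in> G"
        using X tendsto_add[of "\<lambda>k. X (shift k h) - shift k (X h)" 0 F
            "\<lambda>k. Y (shift k h) - shift k (Y h)" 0]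
        by (simp add: G_def blinfun.add_left blinfun.add_right algebra_simps)
    qed
  qed
  with X show ?thesis by (auto simp: G_def)
qed

section \<open>Norms of compressions\<close>

text \<open>Write \<open>a\<^sub>k = P S\<^sub>k h - S\<^sub>k h\<close>, \<open>b\<^sub>k = X S\<^sub>k h - S\<^sub>k X h\<close> and \<open>c\<^sub>k = P S\<^sub>k X h - S\<^sub>k X h\<close>.  Then
  \<open>PXP S\<^sub>k h - S\<^sub>k X h = P X a\<^sub>k + P b\<^sub>k + c\<^sub>k\<close>, where all three terms tend to \<open>0\<close> along the recurrence
  filter.\<close>

lemma norm_le_norm_compression:
  assumes X: "X \<in> complex_vector.span mult_rot_ops"
  shows "norm X \<le> norm (hardy_proj o\<^sub>L X o\<^sub>L hardy_proj)" (is "_ \<le> norm ?Y")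
proof (rule norm_blinfun_bound)
  fix h
  obtain F :: "nat filter" where F: "F \<noteq> bot" "F \<le> sequentially"
      "\<And>\<mu>. \<mu> \<in> sphere (0::complex) 1 \<Longrightarrow> ((\<lambda>k. \<mu> ^ k) \<longlongrightarrow> 1) F"
    using exists_recurrence_filter by blast
  define a where "a k = hardy_proj (shift k h) - shift k h" for k
  define b where "b k = X (shift k h) - shift k (X h)" for k
  define c where "c k = hardy_proj (shift k (X h)) - shift k (X h)" for k
  have "(a \<longlongrightarrow> 0) F" "(c \<longlongrightarrow> 0) F"
    unfolding a_def c_def by (rule tendsto_mono[OF F(2) hardy_proj_shift_tendsto])+
  moreover have "(b \<longlongrightarrow> 0) F"
    unfolding b_def by (rule commutator_tendsto[OF F(3) X])
  ultimately have "((\<lambda>k. hardy_proj (X (a k)) + hardy_proj (b k) + c k)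
      \<longlongrightarrow> hardy_proj (X 0) + hardy_proj 0 + 0) F"
    by (intro tendsto_intros)
  moreover have "hardy_proj (X (a k)) + hardy_proj (b k) + c k = ?Y (shift k h) - shift k (X h)" for k
    by (simp add: a_def b_def c_def blinfun.diff_right)
  ultimately have "((\<lambda>k. ?Y (shift k h) - shift k (X h)) \<longlongrightarrow> 0) F"
    by (simp add: blinfun.zero_right)
  then have "((\<lambda>k. norm ?Y * norm h + norm (?Y (shift k h) - shift k (X h)))
      \<longlongrightarrow> norm ?Y * norm h + norm (0 :: L2)) F"
    by (intro tendsto_intros)
  moreover have "norm (X h) \<le> norm ?Y * norm h + norm (?Y (shift k h) - shift k (X h))" for k
  proof -
    have "norm (X h) = norm (shift k (X h))" by (simp only: norm_shift)
    also have "\<dots> \<le> norm (?Y (shift k h)) + norm (?Y (shift k h) - shift k (X h))"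
      using norm_triangle_ineq4[of "?Y (shift k h)" "?Y (shift k h) - shift k (X h)"] by simp
    also have "norm (?Y (shift k h)) \<le> norm ?Y * norm h"
      using norm_blinfun[of ?Y "shift k h"] by (simp only: norm_shift)
    finally show ?thesis by simp
  qed
  ultimately show "norm (X h) \<le> norm ?Y * norm h"
    using tendsto_lowerbound[OF _ always_eventually F(1)] by fastforce
qed simp

lemma norm_compression_le: "norm (hardy_proj o\<^sub>L X o\<^sub>L hardy_proj) \<le> norm X"
proof (rule norm_blinfun_bound)
  fix h
  have "norm (X (hardy_proj h)) \<le> norm X * norm (hardy_proj h)" by (rule norm_blinfun)
  also have "\<dots> \<le> norm X * norm h" by (intro mult_left_mono norm_hardy_proj_le norm_ge_zero)
  finally show "norm ((hardy_proj o\<^sub>L X o\<^sub>L hardy_proj) h) \<le> norm X * norm h"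
    using norm_hardy_proj_le[of "X (hardy_proj h)"] by simp
qed simp

lemma norm_compression:
  assumes "X \<in> closure (complex_vector.span mult_rot_ops)"
  shows "norm (hardy_proj o\<^sub>L X o\<^sub>L hardy_proj) = norm X"
proof -
  have "closed {X. norm (hardy_proj o\<^sub>L X o\<^sub>L hardy_proj) = norm X}"
    by (intro closed_Collect_eq continuous_intros
        bounded_bilinear.continuous_on[OF bounded_bilinear_blinfun_compose])
  moreover have "complex_vector.span mult_rot_ops
      \<subseteq> {X. norm (hardy_proj o\<^sub>L X o\<^sub>L hardy_proj) = norm X}"
    using norm_le_norm_compression norm_compression_le by (auto intro: antisym)
  ultimately show ?thesis
    using assms closure_minimal by blast
qed

lemma Rep_toeplitz: "Rep_H2 (toeplitz \<mu> f h) = hardy_proj (mult_op f (rot_op \<mu> (Rep_H2 h)))"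
proof -
  let ?A = "hardy_proj o\<^sub>L mult_op f o\<^sub>L rot_op \<mu>"
  let ?T = "\<lambda>h. Abs_H2 (hardy_proj (mult_op f (rot_op \<mu> (Rep_H2 h))))"
  have Rep: "Rep_H2 (?T h) = ?A (Rep_H2 h)" for h
    by (simp add: Abs_H2_inverse hardy_proj_in_hardy)
  have "bounded_linear ?T"
  proof (rule bounded_linear_intro[where K = "norm ?A"])
    show "?T (x + y) = ?T x + ?T y" for x y
      unfolding Rep_H2_inject[symmetric] Rep unfolding Rep_H2_simps Rep by (rule blinfun.add_right)
    show "?T (r *\<^sub>R x) = r *\<^sub>R ?T x" for r x
      unfolding Rep_H2_inject[symmetric] Rep unfolding Rep_H2_simps Rep by (rule blinfun.scaleR_right)
    show "norm (?T x) \<le> norm x * norm ?A" for x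
      unfolding norm_H2_def Rep using norm_blinfun[of ?A "Rep_H2 x"] by (simp only: mult.commute)
  qed
  then have "toeplitz \<mu> f h = ?T h"
    unfolding toeplitz_def by (simp add: bounded_linear_Blinfun_apply)
  then show ?thesis using Rep by simp
qed

lemma Rep_sum_toeplitz:
  "Rep_H2 ((\<Sum>j\<in>J. c j *\<^sub>C toeplitz (\<mu> j) (f j)) h)
    = hardy_proj ((\<Sum>j\<in>J. c j *\<^sub>C (mult_op (f j) o\<^sub>L rot_op (\<mu> j))) (Rep_H2 h))"
proof (induction J rule: infinite_finite_induct)
  case (insert j J)
  then show ?case
    by (simp add: blinfun.add_left blinfun.add_right Rep_H2_simps scaleC_blinfun.rep_eq
        Rep_H2_scaleC Rep_toeplitz hardy_proj_scaleC)
qed (simp_all add: Rep_H2_simps blinfun.zero_right)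

text \<open>The operator \<open>T\<close> is \<open>PXP\<close> restricted to the range of \<open>P\<close>; the norm does not drop under this
  restriction because \<open>PXP\<close> factors through the contraction \<open>P\<close>.\<close>

lemma norm_eq_norm_compression:
  fixes T :: "H2 \<Rightarrow>\<^sub>L H2" and X :: "L2 \<Rightarrow>\<^sub>L L2"
  assumes T: "\<And>h. Rep_H2 (T h) = hardy_proj (X (Rep_H2 h))"
  shows "norm T = norm (hardy_proj o\<^sub>L X o\<^sub>L hardy_proj)" (is "_ = norm ?Y")
proof (rule antisym)
  show "norm T \<le> norm ?Y"
  proof (rule norm_blinfun_bound)
    fix h
    have "norm (T h) = norm (?Y (Rep_H2 h))"
      by (simp add: norm_H2_def T hardy_proj_id Rep_H2)
    then show "norm (T h) \<le> norm ?Y * norm h"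
      using norm_blinfun[of ?Y "Rep_H2 h"] by (simp add: norm_H2_def)
  qed simp
  show "norm ?Y \<le> norm T"
  proof (rule norm_blinfun_bound)
    fix h
    define g where "g = Abs_H2 (hardy_proj h)"
    have g: "Rep_H2 g = hardy_proj h"
      unfolding g_def by (simp add: Abs_H2_inverse hardy_proj_in_hardy)
    have "norm (?Y h) = norm (T g)" by (simp add: norm_H2_def T g)
    also have "\<dots> \<le> norm T * norm g" by (rule norm_blinfun)
    also have "\<dots> \<le> norm T * norm h"
      by (intro mult_left_mono norm_ge_zero) (simp add: norm_H2_def g norm_hardy_proj_le)
    finally show "norm (?Y h) \<le> norm T * norm h" .
  qed simp
qed

theorem mainTheorem6:
  shows "(\<forall>X \<in> closure (complex_vector.span
              {mult_op f o\<^sub>L rot_op \<mu> |f \<mu>. f \<in> Linfty \<and> \<mu> \<in> sphere 0 1}).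
            norm (hardy_proj o\<^sub>L X o\<^sub>L hardy_proj) = norm X) \<and>
         (\<forall>(n::nat) (c :: nat \<Rightarrow> complex) (f :: nat \<Rightarrow> complex \<Rightarrow> complex) (\<mu> :: nat \<Rightarrow> complex).
            (\<forall>j\<in>{1..n}. f j \<in> Linfty \<and> \<mu> j \<in> sphere 0 1) \<longrightarrow>
            norm (\<Sum>j=1..n. c j *\<^sub>C toeplitz (\<mu> j) (f j)) =
            norm (\<Sum>j=1..n. c j *\<^sub>C (mult_op (f j) o\<^sub>L rot_op (\<mu> j))))"
proof (intro conjI allI impI ballI)
  fix X assume "X \<in> closure (complex_vector.span mult_rot_ops)"
  then show "norm (hardy_proj o\<^sub>L X o\<^sub>L hardy_proj) = norm X"
    by (rule norm_compression)
next
  fix n :: nat and c :: "nat \<Rightarrow> complex" and f :: "nat \<Rightarrow> complex \<Rightarrow> complex" and \<mu> :: "nat \<Rightarrow> complex"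
  assume "\<forall>j\<in>{1..n}. f j \<in> Linfty \<and> \<mu> j \<in> sphere 0 1"
  then have "(\<Sum>j=1..n. c j *\<^sub>C (mult_op (f j) o\<^sub>L rot_op (\<mu> j)))
      \<in> complex_vector.span mult_rot_ops"
    by (intro complex_vector.span_sum complex_vector.span_scale complex_vector.span_base) blast
  then have "norm (hardy_proj o\<^sub>L (\<Sum>j=1..n. c j *\<^sub>C (mult_op (f j) o\<^sub>L rot_op (\<mu> j))) o\<^sub>L hardy_proj)
      = norm (\<Sum>j=1..n. c j *\<^sub>C (mult_op (f j) o\<^sub>L rot_op (\<mu> j)))"
    by (intro norm_compression subsetD[OF closure_subset])
  with norm_eq_norm_compression[OF Rep_sum_toeplitz]
  show "norm (\<Sum>j=1..n. c j *\<^sub>C toeplitz (\<mu> j) (f j)) =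
      norm (\<Sum>j=1..n. c j *\<^sub>C (mult_op (f j) o\<^sub>L rot_op (\<mu> j)))"
    by (rule trans)
qed

end
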